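(* Let $\mathbf{k}$ be a commutative ring and let $\mathcal{B}$ be a $\mathbf{k}$-bialgebra with comultiplication $\Delta$ and counit $\epsilon$. Let $\mathcal{B}_+=\ker(\epsilon)$. For each integer $N\ge 0$, let $\mathcal{B}_+^N=\underbrace{\mathcal{B}_+\cdot\mathcal{B}_+\cdots\mathcal{B}_+}_{N\text{ times}}$ (products of $\mathbf{k}$-submodules), where $\mathcal{B}_+^0=\mathcal{B}$. For each integer $N\ge -1$, define a $\mathbf{k}$-submodule $\mathcal{B}_N^\vee$ of $\mathcal{B}^\vee$ by $$\mathcal{B}_N^\vee=\{f\in\mathcal{B}^\vee\mid f(\mathcal{B}_+^{N+1})=0\}.$$ Thus $(\mathcal{B}_{-1}^\vee,\mathcal{B}_0^\vee,\mathcal{B}_1^\vee,\ldots)$ is an increasing filtration of $\mathcal{B}_\infty^\vee:=\bigcup_{N\ge -1}\mathcal{B}_N^\vee$ with $\mathcal{B}_{-1}^\vee=0$. Then: (a) We have $\mathcal{B}_p^\vee\circledast\mathcal{B}_q^\vee\subseteq\mathcal{B}_{p+q}^\vee$ for any integers $p,q\ge -1$ (where we set $\mathcal{B}_{-2}^\vee=0$). Hence $\mathcal{B}_\infty^\vee$ is a subalgebra of the convolution algebra $\mathcal{B}^\vee$. (b) Assume that $\mathbf{k}$ is an integral domain. Then the set $\Xi(\mathcal{B})^\times$ of invertible characters of $\mathcal{B}$ (i.e., of invertible elements of the monoid $\Xi(\mathcal{B})$ of characters of $\mathcal{B}$ under $\circledast$) is left $\mathcal{B}_\infty^\vee$-linearly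 independent.
   Context: All algebras, coalgebras, linear maps and tensor products are over $\mathbf{k}$. A $\mathbf{k}$-bialgebra is a $\mathbf{k}$-module that is both an (associative, unital) $\mathbf{k}$-algebra and a (coassociative, counital) $\mathbf{k}$-coalgebra such that its comultiplication and counit are $\mathbf{k}$-algebra homomorphisms. (No antipode and no commutativity are assumed.) $\mathcal{B}^\vee=\operatorname{Hom}_{\mathbf{k}}(\mathcal{B},\mathbf{k})$ is a $\mathbf{k}$-algebra under convolution $f\circledast g=\mu_{\mathbf{k}}\circ(f\otimes g)\circ\Delta$ (where $\mu_{\mathbf{k}}:\mathbf{k}\otimes\mathbf{k}\to\mathbf{k}$ is multiplication), with unity $\epsilon$. A character of $\mathcal{B}$ is a $\mathbf{k}$-algebra homomorphism $\mathcal{B}\to\mathbf{k}$. The set $\Xi(\mathcal{B})$ of all characters of $\mathcal{B}$ is a monoid under $\circledast$ with neutral element $\epsilon$; $\Xi(\mathcal{B})^\times$ denotes its group of invertible elements (inverses taken in $\Xi(\mathcal{B})$). For a subset $S$ of a $\mathbf{k}$-algebra $A$, elements $g_1,\ldots,g_n\in A$ are left $S$-linearly independent if every $(s_1,\ldots,s_n)\in S^n$ with $\sum_{i=1}^n s_i g_i=0$ satisfies $s_i=0$ for all $i$ (here $A=\mathcal{B}^\vee$ with product $\circledast$). A set of elements is left $S$-linearly independent if any finitely many distinct elements of it are. *)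

theory Defs
  imports "HOL-Algebra.Module" "HOL-Algebra.QuotRing" "HOL-Algebra.Subrings"
begin

text \<open>The library locale \<^locale>\<open>algebra\<close> forces the algebra to be commutative, so noncommutative
  algebras get a locale of their own.\<close>

locale assoc_algebra = module R A + A?: ring A for R (structure) and A (structure) +
  assumes smult_mult_left: "\<lbrakk>a \<in> carrier R; x \<in> carrier A; y \<in> carrier A\<rbrakk>
      \<Longrightarrow> (a \<odot>\<^bsub>A\<^esub> x) \<otimes>\<^bsub>A\<^esub> y = a \<odot>\<^bsub>A\<^esub> (x \<otimes>\<^bsub>A\<^esub> y)"
    and smult_mult_right: "\<lbrakk>a \<in> carrier R; x \<in> carrier A; y \<in> carrier A\<rbrakk>
      \<Longrightarrow> x \<otimes>\<^bsub>A\<^esub> (a \<odot>\<^bsub>A\<^esub> y) = a \<odot>\<^bsub>A\<^esub> (x \<otimes>\<^bsub>A\<^esub> y)"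

definition base_module :: "('k, 'm) ring_scheme \<Rightarrow> ('k, 'k) module" where
  "base_module R = \<lparr>carrier = carrier R, mult = mult R, one = one R, zero = zero R, add = add R,
     smult = mult R\<rparr>"

definition linear_maps ::
  "('k, 'm) ring_scheme \<Rightarrow> ('k, 'a, 'p) module_scheme \<Rightarrow> ('k, 'b, 'q) module_scheme \<Rightarrow> ('a \<Rightarrow> 'b) set"
  where "linear_maps R M N = {f \<in> carrier M \<rightarrow> carrier N.
     (\<forall>x\<in>carrier M. \<forall>y\<in>carrier M. f (x \<oplus>\<^bsub>M\<^esub> y) = f x \<oplus>\<^bsub>N\<^esub> f y) \<and>
     (\<forall>a\<in>carrier R. \<forall>x\<in>carrier M. f (a \<odot>\<^bsub>M\<^esub> x) = a \<odot>\<^bsub>N\<^esub> f x)}"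

definition algebra_homs ::
  "('k, 'm) ring_scheme \<Rightarrow> ('k, 'a, 'p) module_scheme \<Rightarrow> ('k, 'b, 'q) module_scheme \<Rightarrow> ('a \<Rightarrow> 'b) set"
  where "algebra_homs R A A' = linear_maps R A A' \<inter> ring_hom A A'"

definition module_span ::
  "('k, 'm) ring_scheme \<Rightarrow> ('k, 'a, 'p) module_scheme \<Rightarrow> 'a set \<Rightarrow> 'a set"
  where "module_span R M S = \<Inter>{H. submodule H R M \<and> S \<subseteq> H}"

definition submodule_prod ::
  "('k, 'm) ring_scheme \<Rightarrow> ('k, 'a, 'p) module_scheme \<Rightarrow> 'a set \<Rightarrow> 'a set \<Rightarrow> 'a set"
  where "submodule_prod R A U V = module_span R A {u \<otimes>\<^bsub>A\<^esub> v | u v. u \<in> U \<and> v \<in> V}"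

text \<open>The power with exponent zero is the whole algebra, not the span of the unit.\<close>

fun submodule_power ::
  "('k, 'm) ring_scheme \<Rightarrow> ('k, 'a, 'p) module_scheme \<Rightarrow> 'a set \<Rightarrow> nat \<Rightarrow> 'a set"
  where
    "submodule_power R A U 0 = carrier A"
  | "submodule_power R A U (Suc 0) = U"
  | "submodule_power R A U (Suc (Suc n)) = submodule_prod R A (submodule_power R A U (Suc n)) U"

definition is_subalgebra ::
  "('k, 'm) ring_scheme \<Rightarrow> ('k, 'a, 'p) module_scheme \<Rightarrow> 'a set \<Rightarrow> bool"
  where "is_subalgebra R A H \<longleftrightarrow> submodule H R A \<and> subring H A"

text \<open>Finitely supported functions on \<open>S\<close>, extended by zero outside \<open>S\<close>. The ring
  multiplication and unit of this record are irrelevant.\<close>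

definition free_module :: "('k, 'm) ring_scheme \<Rightarrow> 's set \<Rightarrow> ('k, 's \<Rightarrow> 'k) module" where
  "free_module R S = \<lparr>
     carrier = {t. (\<forall>x\<in>S. t x \<in> carrier R) \<and> (\<forall>x. x \<notin> S \<longrightarrow> t x = \<zero>\<^bsub>R\<^esub>) \<and> finite {x. t x \<noteq> \<zero>\<^bsub>R\<^esub>}},
     mult = undefined, one = undefined,
     zero = (\<lambda>x. \<zero>\<^bsub>R\<^esub>), add = (\<lambda>s t x. s x \<oplus>\<^bsub>R\<^esub> t x), smult = (\<lambda>a t x. a \<otimes>\<^bsub>R\<^esub> t x)\<rparr>"

definition free_gen :: "('k, 'm) ring_scheme \<Rightarrow> 's \<Rightarrow> 's \<Rightarrow> 'k" where
  "free_gen R s = (\<lambda>x. if x = s then \<one>\<^bsub>R\<^esub> else \<zero>\<^bsub>R\<^esub>)"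

definition tensor_relations ::
  "('k, 'm) ring_scheme \<Rightarrow> ('k, 'a, 'p) module_scheme \<Rightarrow> ('k, 'b, 'q) module_scheme
    \<Rightarrow> ('a \<times> 'b \<Rightarrow> 'k) set"
  where "tensor_relations R M N = (let F = free_module R (carrier M \<times> carrier N); e = free_gen R in
     {e (x \<oplus>\<^bsub>M\<^esub> x', y) \<ominus>\<^bsub>F\<^esub> (e (x, y) \<oplus>\<^bsub>F\<^esub> e (x', y)) | x x' y.
        x \<in> carrier M \<and> x' \<in> carrier M \<and> y \<in> carrier N} \<union>
     {e (x, y \<oplus>\<^bsub>N\<^esub> y') \<ominus>\<^bsub>F\<^esub> (e (x, y) \<oplus>\<^bsub>F\<^esub> e (x, y')) | x y y'.
        x \<in> carrier M \<and> y \<in> carrier N \<and> y' \<in> carrier N} \<union>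
     {e (a \<odot>\<^bsub>M\<^esub> x, y) \<ominus>\<^bsub>F\<^esub> (a \<odot>\<^bsub>F\<^esub> e (x, y)) | a x y.
        a \<in> carrier R \<and> x \<in> carrier M \<and> y \<in> carrier N} \<union>
     {e (x, a \<odot>\<^bsub>N\<^esub> y) \<ominus>\<^bsub>F\<^esub> (a \<odot>\<^bsub>F\<^esub> e (x, y)) | a x y.
        a \<in> carrier R \<and> x \<in> carrier M \<and> y \<in> carrier N})"

definition tensor_kernel ::
  "('k, 'm) ring_scheme \<Rightarrow> ('k, 'a, 'p) module_scheme \<Rightarrow> ('k, 'b, 'q) module_scheme
    \<Rightarrow> ('a \<times> 'b \<Rightarrow> 'k) set"
  where "tensor_kernel R M N =
     module_span R (free_module R (carrier M \<times> carrier N)) (tensor_relations R M N)"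

text \<open>The quotient module, again with irrelevant ring multiplication and unit. Scalar multiplication
  is written as a union in the style of \<^const>\<open>rcoset_mult\<close>: all the cosets in the union coincide.\<close>

definition tensor ::
  "('k, 'm) ring_scheme \<Rightarrow> ('k, 'a, 'p) module_scheme \<Rightarrow> ('k, 'b, 'q) module_scheme
    \<Rightarrow> ('k, ('a \<times> 'b \<Rightarrow> 'k) set) module"
  where "tensor R M N = (let F = free_module R (carrier M \<times> carrier N); K = tensor_kernel R M N in
     \<lparr>carrier = a_rcosets\<^bsub>F\<^esub> K, mult = undefined, one = undefined,
      zero = K, add = set_add F, smult = (\<lambda>a X. \<Union>t\<in>X. K +>\<^bsub>F\<^esub> (a \<odot>\<^bsub>F\<^esub> t))\<rparr>)"

definition pure_tensor ::
  "('k, 'm) ring_scheme \<Rightarrow> ('k, 'a, 'p) module_scheme \<Rightarrow> ('k, 'b, 'q) module_scheme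
    \<Rightarrow> 'a \<Rightarrow> 'b \<Rightarrow> ('a \<times> 'b \<Rightarrow> 'k) set"
  where "pure_tensor R M N x y =
     tensor_kernel R M N +>\<^bsub>free_module R (carrier M \<times> carrier N)\<^esub> free_gen R (x, y)"

text \<open>The linear map on the tensor product induced by a bilinear map \<open>\<phi>\<close> into \<open>P\<close>. For bilinear
  \<open>\<phi>\<close> the value does not depend on the representative \<open>t\<close> of the coset \<open>X\<close>, so the image of \<open>X\<close>
  is a singleton.\<close>

definition free_lift ::
  "('k, 'm) ring_scheme \<Rightarrow> ('k, 'c, 'r) module_scheme \<Rightarrow> ('a \<Rightarrow> 'b \<Rightarrow> 'c) \<Rightarrow> ('a \<times> 'b \<Rightarrow> 'k) \<Rightarrow> 'c"
  where "free_lift R P \<phi> t = (\<Oplus>\<^bsub>P\<^esub>p\<in>{p. t p \<noteq> \<zero>\<^bsub>R\<^esub>}. t p \<odot>\<^bsub>P\<^esub> \<phi> (fst p) (snd p))"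

definition tensor_lift ::
  "('k, 'm) ring_scheme \<Rightarrow> ('k, 'c, 'r) module_scheme \<Rightarrow> ('a \<Rightarrow> 'b \<Rightarrow> 'c)
    \<Rightarrow> ('a \<times> 'b \<Rightarrow> 'k) set \<Rightarrow> 'c"
  where "tensor_lift R P \<phi> X = the_elem (free_lift R P \<phi> ` X)"

text \<open>The map \<open>f \<otimes> g\<close>; its source modules do not enter the formula, only the targets \<open>M'\<close> and \<open>N'\<close>.\<close>

definition tensor_map ::
  "('k, 'm) ring_scheme \<Rightarrow> ('k, 'c, 'p) module_scheme \<Rightarrow> ('k, 'd, 'q) module_scheme
    \<Rightarrow> ('a \<Rightarrow> 'c) \<Rightarrow> ('b \<Rightarrow> 'd) \<Rightarrow> ('a \<times> 'b \<Rightarrow> 'k) set \<Rightarrow> ('c \<times> 'd \<Rightarrow> 'k) set"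
  where "tensor_map R M' N' f g =
     tensor_lift R (tensor R M' N') (\<lambda>x y. pure_tensor R M' N' (f x) (g y))"

text \<open>The canonical isomorphism \<open>(M \<otimes> N) \<otimes> P \<rightarrow> M \<otimes> (N \<otimes> P)\<close>.\<close>

definition tensor_assoc ::
  "('k, 'm) ring_scheme \<Rightarrow> ('k, 'a, 'p) module_scheme \<Rightarrow> ('k, 'b, 'q) module_scheme
    \<Rightarrow> ('k, 'c, 'r) module_scheme
    \<Rightarrow> (('a \<times> 'b \<Rightarrow> 'k) set \<times> 'c \<Rightarrow> 'k) set \<Rightarrow> ('a \<times> ('b \<times> 'c \<Rightarrow> 'k) set \<Rightarrow> 'k) set"
  where "tensor_assoc R M N P =
     tensor_lift R (tensor R M (tensor R N P)) (\<lambda>X z.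
       tensor_lift R (tensor R M (tensor R N P))
         (\<lambda>x y. pure_tensor R M (tensor R N P) x (pure_tensor R N P y z)) X)"

text \<open>The tensor product of two algebras, with \<open>(a \<otimes> b) (c \<otimes> d) = ac \<otimes> bd\<close>.\<close>

definition tensor_algebra ::
  "('k, 'm) ring_scheme \<Rightarrow> ('k, 'a, 'p) module_scheme \<Rightarrow> ('k, 'b, 'q) module_scheme
    \<Rightarrow> ('k, ('a \<times> 'b \<Rightarrow> 'k) set) module"
  where "tensor_algebra R A B = (tensor R A B)
     \<lparr>mult := (\<lambda>X Y. tensor_lift R (tensor R A B) (\<lambda>a b. tensor_lift R (tensor R A B)
         (\<lambda>c d. pure_tensor R A B (a \<otimes>\<^bsub>A\<^esub> c) (b \<otimes>\<^bsub>B\<^esub> d)) Y) X),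
      one := pure_tensor R A B \<one>\<^bsub>A\<^esub> \<one>\<^bsub>B\<^esub>\<rparr>"

text \<open>The counit axioms use the canonical isomorphisms \<open>R \<otimes> B \<rightarrow> B\<close> and \<open>B \<otimes> R \<rightarrow> B\<close>.\<close>

locale coalgebra = module R C for R (structure) and C (structure) +
  fixes \<Delta> :: "'c \<Rightarrow> ('c \<times> 'c \<Rightarrow> 'a) set" and \<epsilon> :: "'c \<Rightarrow> 'a"
  assumes comult_linear: "\<Delta> \<in> linear_maps R C (tensor R C C)"
    and counit_linear: "\<epsilon> \<in> linear_maps R C (base_module R)"
    and coassoc: "x \<in> carrier C \<Longrightarrow>
      tensor_assoc R C C C (tensor_map R (tensor R C C) C \<Delta> (\<lambda>c. c) (\<Delta> x)) =
      tensor_map R C (tensor R C C) (\<lambda>c. c) \<Delta> (\<Delta> x)"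
    and counit_left: "x \<in> carrier C \<Longrightarrow>
      tensor_lift R C (\<lambda>a c. a \<odot>\<^bsub>C\<^esub> c) (tensor_map R (base_module R) C \<epsilon> (\<lambda>c. c) (\<Delta> x)) = x"
    and counit_right: "x \<in> carrier C \<Longrightarrow>
      tensor_lift R C (\<lambda>c a. a \<odot>\<^bsub>C\<^esub> c) (tensor_map R C (base_module R) (\<lambda>c. c) \<epsilon> (\<Delta> x)) = x"

locale bialgebra = assoc_algebra R B + coalgebra R B \<Delta> \<epsilon>
  for R (structure) and B (structure) and \<Delta> and \<epsilon> +
  assumes comult_hom: "\<Delta> \<in> algebra_homs R B (tensor_algebra R B B)"
    and counit_hom: "\<epsilon> \<in> algebra_homs R B (base_module R)"

text \<open>Functions on \<open>carrier B\<close> are made \<^const>\<open>extensional\<close>, so that equality of linear forms and of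
  characters is equality of HOL functions.\<close>

definition convolution ::
  "('k, 'm) ring_scheme \<Rightarrow> ('k, 'b, 'p) module_scheme \<Rightarrow> ('b \<Rightarrow> ('b \<times> 'b \<Rightarrow> 'k) set)
    \<Rightarrow> ('b \<Rightarrow> 'k) \<Rightarrow> ('b \<Rightarrow> 'k) \<Rightarrow> 'b \<Rightarrow> 'k"
  where "convolution R B \<Delta> f g = (\<lambda>x\<in>carrier B.
     tensor_lift R (base_module R) (\<lambda>a b. a \<otimes>\<^bsub>R\<^esub> b)
       (tensor_map R (base_module R) (base_module R) f g (\<Delta> x)))"

definition dual_algebra ::
  "('k, 'm) ring_scheme \<Rightarrow> ('k, 'b, 'p) module_scheme \<Rightarrow> ('b \<Rightarrow> ('b \<times> 'b \<Rightarrow> 'k) set) \<Rightarrow> ('b \<Rightarrow> 'k)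
    \<Rightarrow> ('k, 'b \<Rightarrow> 'k) module"
  where "dual_algebra R B \<Delta> \<epsilon> = \<lparr>
     carrier = linear_maps R B (base_module R) \<inter> extensional (carrier B),
     mult = convolution R B \<Delta>,
     one = restrict \<epsilon> (carrier B),
     zero = (\<lambda>x\<in>carrier B. \<zero>\<^bsub>R\<^esub>),
     add = (\<lambda>f g. \<lambda>x\<in>carrier B. f x \<oplus>\<^bsub>R\<^esub> g x),
     smult = (\<lambda>a f. \<lambda>x\<in>carrier B. a \<otimes>\<^bsub>R\<^esub> f x)\<rparr>"

definition character_monoid ::
  "('k, 'm) ring_scheme \<Rightarrow> ('k, 'b, 'p) module_scheme \<Rightarrow> ('b \<Rightarrow> ('b \<times> 'b \<Rightarrow> 'k) set) \<Rightarrow> ('b \<Rightarrow> 'k)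
    \<Rightarrow> ('b \<Rightarrow> 'k) monoid"
  where "character_monoid R B \<Delta> \<epsilon> = \<lparr>
     carrier = algebra_homs R B (base_module R) \<inter> extensional (carrier B),
     mult = convolution R B \<Delta>,
     one = restrict \<epsilon> (carrier B)\<rparr>"

definition augmentation_ideal ::
  "('k, 'm) ring_scheme \<Rightarrow> ('k, 'b, 'p) module_scheme \<Rightarrow> ('b \<Rightarrow> 'k) \<Rightarrow> 'b set"
  where "augmentation_ideal R B \<epsilon> = a_kernel B R \<epsilon>"

text \<open>Indices below \<open>-1\<close> give the zero submodule; only the index \<open>-2\<close> is needed.\<close>

definition dual_filtration ::
  "('k, 'm) ring_scheme \<Rightarrow> ('k, 'b, 'p) module_scheme \<Rightarrow> ('b \<Rightarrow> ('b \<times> 'b \<Rightarrow> 'k) set) \<Rightarrow> ('b \<Rightarrow> 'k)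
    \<Rightarrow> int \<Rightarrow> ('b \<Rightarrow> 'k) set"
  where "dual_filtration R B \<Delta> \<epsilon> N =
     (if N \<ge> -1
      then {f \<in> carrier (dual_algebra R B \<Delta> \<epsilon>).
              \<forall>x\<in>submodule_power R B (augmentation_ideal R B \<epsilon>) (nat (N + 1)). f x = \<zero>\<^bsub>R\<^esub>}
      else {\<zero>\<^bsub>dual_algebra R B \<Delta> \<epsilon>\<^esub>})"

definition dual_filtration_union ::
  "('k, 'm) ring_scheme \<Rightarrow> ('k, 'b, 'p) module_scheme \<Rightarrow> ('b \<Rightarrow> ('b \<times> 'b \<Rightarrow> 'k) set) \<Rightarrow> ('b \<Rightarrow> 'k)
    \<Rightarrow> ('b \<Rightarrow> 'k) set"
  where "dual_filtration_union R B \<Delta> \<epsilon> = (\<Union>N\<in>{-1..}. dual_filtration R B \<Delta> \<epsilon> N)"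

definition left_lin_indep_family ::
  "('a, 'm) ring_scheme \<Rightarrow> 'a set \<Rightarrow> nat \<Rightarrow> (nat \<Rightarrow> 'a) \<Rightarrow> bool"
  where "left_lin_indep_family A S n g \<longleftrightarrow>
     (\<forall>s\<in>{..<n} \<rightarrow> S. (\<Oplus>\<^bsub>A\<^esub>i\<in>{..<n}. s i \<otimes>\<^bsub>A\<^esub> g i) = \<zero>\<^bsub>A\<^esub> \<longrightarrow> (\<forall>i<n. s i = \<zero>\<^bsub>A\<^esub>))"

definition left_lin_indep_set :: "('a, 'm) ring_scheme \<Rightarrow> 'a set \<Rightarrow> 'a set \<Rightarrow> bool"
  where "left_lin_indep_set A S G \<longleftrightarrow>
     (\<forall>n g. g \<in> {..<n} \<rightarrow> G \<longrightarrow> inj_on g {..<n} \<longrightarrow> left_lin_indep_family A S n g)"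

end

theory Submission
  imports Defs
begin

text \<open>
  Write \<open>J\<close> for the augmentation ideal \<open>ker \<epsilon>\<close>. Both parts rest on how convolution interacts with
  powers of ideals.

  For the filtration, \<open>B \<otimes> B\<close> is filtered by \<open>T\<^sub>n = \<Sum>\<^bsub>i+j=n\<^esub> J\<^sup>i \<otimes> J\<^sup>j\<close>. This filtration is
  multiplicative, and \<open>\<Delta>\<close> maps \<open>J\<close> into \<open>T\<^sub>1\<close> because an element of \<open>B \<otimes> B\<close> differs from
  its image under \<open>\<epsilon> \<otimes> \<epsilon>\<close>, viewed as a multiple of \<open>1 \<otimes> 1\<close>, by an element of \<open>T\<^sub>1\<close>. As \<open>\<Delta>\<close>
  is multiplicative, it maps \<open>J\<^sup>n\<close> into \<open>T\<^sub>n\<close> (\<open>comult_Jpow\<close>). If \<open>f\<close> kills \<open>J\<^bsup>p+1\<^esup>\<close>, \<open>g\<close> kills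
  \<open>J\<^bsup>q+1\<^esup>\<close> and \<open>i + j = p + q + 1\<close>, then \<open>i > p\<close> or \<open>j > q\<close>, so \<open>f \<otimes> g\<close> kills
  \<open>T\<^bsub>p+q+1\<^esub>\<close> and the convolution of \<open>f\<close> and \<open>g\<close> kills \<open>J\<^bsup>p+q+1\<^esup>\<close>
  (\<open>convolution_vanishes_on_Jpow\<close>).

  For the independence, let \<open>g\<close> be a character. The translation \<open>x \<mapsto> \<Sum> g(x\<^sub>2) x\<^sub>1\<close> is
  multiplicative and maps \<open>ker g\<close> into \<open>J\<close>, and the convolution of \<open>f\<close> with \<open>g\<close> is \<open>f\<close> composed
  with it. Hence, if \<open>f\<close> kills \<open>J\<^sup>n\<close>, the convolution of \<open>f\<close> and \<open>g\<close> kills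
  \<open>(ker g)\<^sup>n\<close> (\<open>convolution_vanishes_on_kernel_power\<close>): it is a generalized eigenvector of the
  action of \<open>B\<close> on its dual, with eigenvalue \<open>g\<close>. Over a domain, generalized eigenvectors with
  distinct eigenvalues are independent (\<open>generalized_eigenfunctionals_independent\<close>), so in a relation
  \<open>\<Sum> s\<^sub>i \<circledast> g\<^sub>i = 0\<close> every single product \<open>s\<^sub>i \<circledast> g\<^sub>i\<close> vanishes. Multiplying by the inverse
  of \<open>g\<^sub>i\<close> gives \<open>s\<^sub>i = 0\<close>.

  The tensor product is used only through its universal property: linear maps on it agree as soon as
  they agree on pure tensors, which replaces computations with Sweedler sums.
\<close>

section \<open>Linear and bilinear maps\<close>

lemma linear_mapsI:
  assumes "\<And>x. x \<in> carrier M \<Longrightarrow> f x \<in> carrier N"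
    and "\<And>x y. \<lbrakk>x \<in> carrier M; y \<in> carrier M\<rbrakk> \<Longrightarrow> f (x \<oplus>\<^bsub>M\<^esub> y) = f x \<oplus>\<^bsub>N\<^esub> f y"
    and "\<And>a x. \<lbrakk>a \<in> carrier R; x \<in> carrier M\<rbrakk> \<Longrightarrow> f (a \<odot>\<^bsub>M\<^esub> x) = a \<odot>\<^bsub>N\<^esub> f x"
  shows "f \<in> linear_maps R M N"
  using assms by (auto simp: linear_maps_def)

lemma linear_mapsD:
  assumes "f \<in> linear_maps R M N"
  shows "x \<in> carrier M \<Longrightarrow> f x \<in> carrier N"
    and "\<lbrakk>x \<in> carrier M; y \<in> carrier M\<rbrakk> \<Longrightarrow> f (x \<oplus>\<^bsub>M\<^esub> y) = f x \<oplus>\<^bsub>N\<^esub> f y"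
    and "\<lbrakk>a \<in> carrier R; x \<in> carrier M\<rbrakk> \<Longrightarrow> f (a \<odot>\<^bsub>M\<^esub> x) = a \<odot>\<^bsub>N\<^esub> f x"
  using assms by (auto simp: linear_maps_def)

lemma linear_maps_compose:
  assumes "f \<in> linear_maps R M N" and "g \<in> linear_maps R N P"
  shows "(\<lambda>x. g (f x)) \<in> linear_maps R M P"
  using assms by (auto simp: linear_maps_def Pi_def)

lemma linear_maps_zero:
  assumes "module R M" and "module R N" and "f \<in> linear_maps R M N"
  shows "f \<zero>\<^bsub>M\<^esub> = \<zero>\<^bsub>N\<^esub>"
proof -
  interpret M: module R M by fact
  interpret N: module R N by fact
  have "f (\<zero>\<^bsub>R\<^esub> \<odot>\<^bsub>M\<^esub> \<zero>\<^bsub>M\<^esub>) = \<zero>\<^bsub>R\<^esub> \<odot>\<^bsub>N\<^esub> f \<zero>\<^bsub>M\<^esub>"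
    using linear_mapsD(3)[OF assms(3)] by blast
  then show ?thesis
    using linear_mapsD(1)[OF assms(3)] by simp
qed

lemma linear_maps_a_inv:
  assumes "module R M" and "module R N" and f: "f \<in> linear_maps R M N" and x: "x \<in> carrier M"
  shows "f (\<ominus>\<^bsub>M\<^esub> x) = \<ominus>\<^bsub>N\<^esub> f x"
proof -
  interpret M: module R M by fact
  interpret N: module R N by fact
  have "f x \<oplus>\<^bsub>N\<^esub> f (\<ominus>\<^bsub>M\<^esub> x) = \<zero>\<^bsub>N\<^esub>"
    using linear_mapsD(2)[OF f x, of "\<ominus>\<^bsub>M\<^esub> x"] x linear_maps_zero[OF assms(1-3)]
    by (simp add: M.r_neg)
  then show ?thesis
    using linear_mapsD(1)[OF f] x by (metis M.a_inv_closed N.minus_equality N.a_comm)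
qed

lemma linear_maps_minus:
  assumes "module R M" and "module R N" and f: "f \<in> linear_maps R M N"
    and x: "x \<in> carrier M" "y \<in> carrier M"
  shows "f (x \<ominus>\<^bsub>M\<^esub> y) = f x \<ominus>\<^bsub>N\<^esub> f y"
proof -
  interpret M: module R M by fact
  show ?thesis
    using x linear_mapsD(2)[OF f x(1), of "\<ominus>\<^bsub>M\<^esub> y"] linear_maps_a_inv[OF assms(1-3) x(2)]
    by (simp add: a_minus_def)
qed

text \<open>The workhorse for spans: a linear condition that puts values into a submodule holds on a whole
  span once it holds on the generators.\<close>

lemma submodule_vimage:
  assumes M: "module R M" and N: "module R N" and f: "f \<in> linear_maps R M N"
    and H: "submodule H R N"
  shows "submodule {x \<in> carrier M. f x \<in> H} R M"
proof -
  interpret M: module R M by fact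
  interpret N: module R N by fact
  interpret H: submodule H R N by fact
  show ?thesis
    using H.one_closed H.m_closed N.submoduleE(3)[OF H]
    by (intro M.submoduleI)
      (auto simp: linear_maps_zero[OF M N f] linear_maps_a_inv[OF M N f] linear_mapsD[OF f])
qed

lemma (in module) zero_submodule: "submodule {\<zero>\<^bsub>M\<^esub>} R M"
  by (rule submoduleI) auto

lemma submodule_kernel:
  assumes M: "module R M" and N: "module R N" and f: "f \<in> linear_maps R M N"
  shows "submodule {x \<in> carrier M. f x = \<zero>\<^bsub>N\<^esub>} R M"
  using submodule_vimage[OF M N f module.zero_submodule[OF N]] by simp

lemma submodule_Inter:
  assumes M: "module R M" and "\<H> \<noteq> {}" and sub: "\<And>H. H \<in> \<H> \<Longrightarrow> submodule H R M"
  shows "submodule (\<Inter>\<H>) R M"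
proof -
  interpret M: module R M by fact
  show ?thesis
    using \<open>\<H> \<noteq> {}\<close> M.submoduleE[OF sub] subgroup.one_closed[OF submodule.axioms(1)[OF sub]]
    by (intro M.submoduleI) (simp_all, blast)
qed

lemma submodule_module_span:
  assumes M: "module R M" and "S \<subseteq> carrier M"
  shows "submodule (module_span R M S) R M"
  unfolding module_span_def
  using assms module.carrier_is_submodule[OF M] by (intro submodule_Inter) auto

lemma module_span_superset: "S \<subseteq> module_span R M S"
  by (auto simp: module_span_def)

lemma module_span_least: "\<lbrakk>submodule H R M; S \<subseteq> H\<rbrakk> \<Longrightarrow> module_span R M S \<subseteq> H"
  by (auto simp: module_span_def)

definition bilinear_maps ::
  "('k, 'm) ring_scheme \<Rightarrow> ('k, 'a, 'p) module_scheme \<Rightarrow> ('k, 'b, 'q) module_scheme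
    \<Rightarrow> ('k, 'c, 'r) module_scheme \<Rightarrow> ('a \<Rightarrow> 'b \<Rightarrow> 'c) set"
  where "bilinear_maps R M N P = {\<phi>.
     (\<forall>x\<in>carrier M. \<phi> x \<in> linear_maps R N P) \<and>
     (\<forall>y\<in>carrier N. (\<lambda>x. \<phi> x y) \<in> linear_maps R M P)}"

lemma bilinear_mapsI:
  assumes "\<And>x. x \<in> carrier M \<Longrightarrow> \<phi> x \<in> linear_maps R N P"
    and "\<And>y. y \<in> carrier N \<Longrightarrow> (\<lambda>x. \<phi> x y) \<in> linear_maps R M P"
  shows "\<phi> \<in> bilinear_maps R M N P"
  using assms by (auto simp: bilinear_maps_def)

lemma bilinear_mapsD:
  assumes "\<phi> \<in> bilinear_maps R M N P"
  shows "x \<in> carrier M \<Longrightarrow> \<phi> x \<in> linear_maps R N P"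
    and "y \<in> carrier N \<Longrightarrow> (\<lambda>x. \<phi> x y) \<in> linear_maps R M P"
  using assms by (auto simp: bilinear_maps_def)

lemma bilinear_maps_closed:
  "\<lbrakk>\<phi> \<in> bilinear_maps R M N P; x \<in> carrier M; y \<in> carrier N\<rbrakk> \<Longrightarrow> \<phi> x y \<in> carrier P"
  by (meson bilinear_mapsD(1) linear_mapsD(1))

lemma bilinear_maps_compose:
  assumes "\<phi> \<in> bilinear_maps R M N P"
    and "f \<in> linear_maps R M' M" and "g \<in> linear_maps R N' N"
  shows "(\<lambda>x y. \<phi> (f x) (g y)) \<in> bilinear_maps R M' N' P"
  using assms by (auto simp: bilinear_maps_def linear_maps_def Pi_def)

lemma base_module_simps [simp]:
  "carrier (base_module R) = carrier R" "add (base_module R) = add R"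
  "zero (base_module R) = zero R" "one (base_module R) = one R"
  "mult (base_module R) = mult R" "smult (base_module R) = mult R"
  by (simp_all add: base_module_def)

lemma base_module_a_minus [simp]:
  "a_inv (base_module R) = a_inv R" "a_minus (base_module R) = a_minus R"
  by (simp_all add: fun_eq_iff a_inv_def a_minus_def m_inv_def)

lemma (in cring) base_module_is_module: "module R (base_module R)"
proof (rule moduleI)
  show "abelian_group (base_module R)"
    by (rule abelian_groupI) (auto simp: a_ac intro: l_neg)
qed (use cring_axioms in \<open>auto simp: l_distr r_distr m_assoc\<close>)

lemma (in cring) mult_bilinear:
  "mult R \<in> bilinear_maps R (base_module R) (base_module R) (base_module R)"
  by (auto intro!: bilinear_mapsI linear_mapsI simp: l_distr r_distr m_ac)


section \<open>The universal property of the tensor product\<close>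

lemma free_module_simps:
  "zero (free_module R S) = (\<lambda>x. \<zero>\<^bsub>R\<^esub>)"
  "add (free_module R S) = (\<lambda>s t x. s x \<oplus>\<^bsub>R\<^esub> t x)"
  "smult (free_module R S) = (\<lambda>a t x. a \<otimes>\<^bsub>R\<^esub> t x)"
  by (simp_all add: free_module_def)

lemma carrier_free_module:
  "t \<in> carrier (free_module R S) \<longleftrightarrow>
     (\<forall>x\<in>S. t x \<in> carrier R) \<and> (\<forall>x. x \<notin> S \<longrightarrow> t x = \<zero>\<^bsub>R\<^esub>) \<and> finite {x. t x \<noteq> \<zero>\<^bsub>R\<^esub>}"
  by (simp add: free_module_def)

lemma (in cring) free_module_coeff:
  "t \<in> carrier (free_module R S) \<Longrightarrow> t x \<in> carrier R"
  by (cases "x \<in> S") (auto simp: carrier_free_module)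

lemma (in cring) free_module_is_module: "module R (free_module R S)"
proof (rule moduleI)
  have add: "(\<lambda>x. s x \<oplus> t x) \<in> carrier (free_module R S)"
    if "s \<in> carrier (free_module R S)" "t \<in> carrier (free_module R S)" for s t
  proof -
    have "{x. s x \<oplus> t x \<noteq> \<zero>} \<subseteq> {x. s x \<noteq> \<zero>} \<union> {x. t x \<noteq> \<zero>}" by auto
    moreover have "finite \<dots>" using that by (simp add: carrier_free_module)
    ultimately show ?thesis using that by (auto simp: carrier_free_module intro: finite_subset)
  qed
  have smult: "(\<lambda>x. a \<otimes> t x) \<in> carrier (free_module R S)"
    if "a \<in> carrier R" "t \<in> carrier (free_module R S)" for a t
  proof -
    have "{x. a \<otimes> t x \<noteq> \<zero>} \<subseteq> {x. t x \<noteq> \<zero>}" using that by auto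
    then show ?thesis using that by (auto simp: carrier_free_module intro: finite_subset)
  qed
  show "abelian_group (free_module R S)"
  proof (rule abelian_groupI)
    fix t assume t: "t \<in> carrier (free_module R S)"
    show "\<exists>s\<in>carrier (free_module R S). s \<oplus>\<^bsub>free_module R S\<^esub> t = \<zero>\<^bsub>free_module R S\<^esub>"
    proof (rule bexI)
      show "(\<lambda>x. (\<ominus> \<one>) \<otimes> t x) \<in> carrier (free_module R S)"
        using t by (intro smult) auto
      show "(\<lambda>x. \<ominus> \<one> \<otimes> t x) \<oplus>\<^bsub>free_module R S\<^esub> t = \<zero>\<^bsub>free_module R S\<^esub>"
        using free_module_coeff[OF t] by (simp add: free_module_simps l_minus l_neg)
    qed
  qed (use add free_module_coeff[where S = S] in
      \<open>simp_all add: free_module_simps a_ac\<close>, simp add: carrier_free_module)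
  show "a \<odot>\<^bsub>free_module R S\<^esub> t \<in> carrier (free_module R S)"
    if "a \<in> carrier R" "t \<in> carrier (free_module R S)" for a t
    using that by (simp add: free_module_simps smult)
qed (use cring_axioms free_module_coeff[where S = S] in
    \<open>simp_all add: free_module_simps l_distr r_distr m_assoc\<close>)

lemma (in cring) free_gen_closed: "p \<in> S \<Longrightarrow> free_gen R p \<in> carrier (free_module R S)"
  by (auto simp: free_module_simps carrier_free_module free_gen_def)

lemma (in cring) free_module_induct [consumes 1, case_names zero step]:
  assumes t: "t \<in> carrier (free_module R S)"
    and zero: "Q \<zero>\<^bsub>free_module R S\<^esub>"
    and step: "\<And>a p t. \<lbrakk>a \<in> carrier R; p \<in> S; t \<in> carrier (free_module R S); Q t\<rbrakk> \<Longrightarrow>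
      Q (a \<odot>\<^bsub>free_module R S\<^esub> free_gen R p \<oplus>\<^bsub>free_module R S\<^esub> t)"
  shows "Q t"
proof -
  have "finite A \<Longrightarrow> {p. t p \<noteq> \<zero>} = A \<Longrightarrow> t \<in> carrier (free_module R S) \<Longrightarrow> Q t" for A t
  proof (induction A arbitrary: t rule: finite_induct)
    case empty
    then have "t = \<zero>\<^bsub>free_module R S\<^esub>" by (auto simp: free_module_simps)
    with zero show ?case by simp
  next
    case (insert p A)
    define s where "s = t(p := \<zero>)"
    have supp: "{q. s q \<noteq> \<zero>} = A"
      using insert.hyps insert.prems(1) by (auto simp: s_def)
    have s: "s \<in> carrier (free_module R S)"
      using insert.prems(2) supp \<open>finite A\<close> by (auto simp: free_module_simps carrier_free_module s_def)
    have p: "p \<in> S"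
      using insert.prems by (auto simp: free_module_simps carrier_free_module)
    have tp: "t q \<in> carrier R" for q
      using free_module_coeff[OF insert.prems(2)] .
    have "t = t p \<odot>\<^bsub>free_module R S\<^esub> free_gen R p \<oplus>\<^bsub>free_module R S\<^esub> s"
      using tp by (auto simp: free_module_simps s_def free_gen_def)
    moreover have "Q \<dots>" by (rule step[OF tp p s insert.IH[OF supp s]])
    ultimately show ?case by simp
  qed
  with t show ?thesis by (auto simp: free_module_simps carrier_free_module)
qed

text \<open>The sum defining \<^const>\<open>free_lift\<close> may be taken over any finite set containing the support,
  which puts the values at two different arguments over a common index set.\<close>

lemma free_lift_superset:
  assumes P: "module R P" and t: "t \<in> carrier (free_module R S)"
    and A: "finite A" "{p. t p \<noteq> \<zero>\<^bsub>R\<^esub>} \<subseteq> A" "A \<subseteq> S"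
    and \<phi>: "\<And>x y. (x, y) \<in> S \<Longrightarrow> \<phi> x y \<in> carrier P"
  shows "free_lift R P \<phi> t = (\<Oplus>\<^bsub>P\<^esub>p\<in>A. t p \<odot>\<^bsub>P\<^esub> \<phi> (fst p) (snd p))"
proof -
  interpret P: module R P by fact
  show ?thesis
    unfolding free_lift_def
    using A \<phi> P.R.free_module_coeff[OF t]
    by (intro P.add.finprod_mono_neutral_cong_left) (auto simp: subset_iff)
qed

lemma free_lift_linear:
  assumes P: "module R P" and \<phi>: "\<And>x y. (x, y) \<in> S \<Longrightarrow> \<phi> x y \<in> carrier P"
  shows "free_lift R P \<phi> \<in> linear_maps R (free_module R S) P"
proof -
  interpret P: module R P by fact
  interpret F: module R "free_module R S" by (rule P.R.free_module_is_module)
  have sup: "{p. t p \<noteq> \<zero>\<^bsub>R\<^esub>} \<subseteq> S" "finite {p. t p \<noteq> \<zero>\<^bsub>R\<^esub>}"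
    if "t \<in> carrier (free_module R S)" for t
    using that by (auto simp: carrier_free_module)
  note coeff = P.R.free_module_coeff[where S = S]
  have mem: "(\<lambda>p. t p \<odot>\<^bsub>P\<^esub> \<phi> (fst p) (snd p)) \<in> A \<rightarrow> carrier P"
    if "t \<in> carrier (free_module R S)" "A \<subseteq> S" for t A
    using that coeff \<phi> by auto
  show ?thesis
  proof (rule linear_mapsI)
    fix t assume t: "t \<in> carrier (free_module R S)"
    show "free_lift R P \<phi> t \<in> carrier P"
      unfolding free_lift_def by (intro P.finsum_closed mem t sup)
  next
    fix s t assume st: "s \<in> carrier (free_module R S)" "t \<in> carrier (free_module R S)"
    let ?A = "{p. s p \<noteq> \<zero>\<^bsub>R\<^esub>} \<union> {p. t p \<noteq> \<zero>\<^bsub>R\<^esub>}"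
    have A: "finite ?A" "?A \<subseteq> S" using sup st by auto
    have "free_lift R P \<phi> (s \<oplus>\<^bsub>free_module R S\<^esub> t) =
        (\<Oplus>\<^bsub>P\<^esub>p\<in>?A. (s \<oplus>\<^bsub>free_module R S\<^esub> t) p \<odot>\<^bsub>P\<^esub> \<phi> (fst p) (snd p))"
      using A st \<phi> by (intro free_lift_superset[OF P F.a_closed]) (auto simp: free_module_simps)
    also have "\<dots> = (\<Oplus>\<^bsub>P\<^esub>p\<in>?A. s p \<odot>\<^bsub>P\<^esub> \<phi> (fst p) (snd p) \<oplus>\<^bsub>P\<^esub> t p \<odot>\<^bsub>P\<^esub> \<phi> (fst p) (snd p))"
      using A(2) mem[OF st(1)] mem[OF st(2)] coeff[OF st(1)] coeff[OF st(2)] \<phi>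
      by (intro P.finsum_cong') (auto simp: free_module_simps P.smult_l_distr)
    also have "\<dots> = (\<Oplus>\<^bsub>P\<^esub>p\<in>?A. s p \<odot>\<^bsub>P\<^esub> \<phi> (fst p) (snd p)) \<oplus>\<^bsub>P\<^esub>
        (\<Oplus>\<^bsub>P\<^esub>p\<in>?A. t p \<odot>\<^bsub>P\<^esub> \<phi> (fst p) (snd p))"
      by (intro P.finsum_addf mem st A)
    also have "\<dots> = free_lift R P \<phi> s \<oplus>\<^bsub>P\<^esub> free_lift R P \<phi> t"
      using A \<phi> st by (simp add: free_lift_superset[OF P, of _ S ?A])
    finally show "free_lift R P \<phi> (s \<oplus>\<^bsub>free_module R S\<^esub> t) =
      free_lift R P \<phi> s \<oplus>\<^bsub>P\<^esub> free_lift R P \<phi> t" .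
  next
    fix a t assume a: "a \<in> carrier R" and t: "t \<in> carrier (free_module R S)"
    let ?A = "{p. t p \<noteq> \<zero>\<^bsub>R\<^esub>}"
    have "free_lift R P \<phi> (a \<odot>\<^bsub>free_module R S\<^esub> t) =
        (\<Oplus>\<^bsub>P\<^esub>p\<in>?A. (a \<odot>\<^bsub>free_module R S\<^esub> t) p \<odot>\<^bsub>P\<^esub> \<phi> (fst p) (snd p))"
      using a t sup[OF t] \<phi> by (intro free_lift_superset[OF P F.smult_closed]) (auto simp: free_module_simps)
    also have "\<dots> = (\<Oplus>\<^bsub>P\<^esub>p\<in>?A. a \<odot>\<^bsub>P\<^esub> (t p \<odot>\<^bsub>P\<^esub> \<phi> (fst p) (snd p)))"
      using a sup(1)[OF t] coeff[OF t] \<phi>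
      by (intro P.finsum_cong') (auto simp: free_module_simps P.smult_assoc1 subset_iff)
    also have "\<dots> = a \<odot>\<^bsub>P\<^esub> free_lift R P \<phi> t"
      unfolding free_lift_def
      by (intro P.finsum_smult_ldistr[symmetric] a mem t sup)
    finally show "free_lift R P \<phi> (a \<odot>\<^bsub>free_module R S\<^esub> t) = a \<odot>\<^bsub>P\<^esub> free_lift R P \<phi> t" .
  qed
qed

lemma free_lift_gen:
  assumes P: "module R P" and "\<phi> x y \<in> carrier P"
  shows "free_lift R P \<phi> (free_gen R (x, y)) = \<phi> x y"
proof -
  interpret P: module R P by fact
  have "free_lift R P \<phi> (free_gen R (x, y)) =
      (\<Oplus>\<^bsub>P\<^esub>p\<in>{(x, y)}. free_gen R (x, y) p \<odot>\<^bsub>P\<^esub> \<phi> (fst p) (snd p))"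
    using assms by (intro free_lift_superset[OF P P.R.free_gen_closed]) (auto simp: free_gen_def)
  also have "\<dots> = \<phi> x y"
    using assms by (simp add: free_gen_def)
  finally show ?thesis .
qed

locale module_pair = M: module R M + N: module R N for R (structure) and M and N
begin

abbreviation "F \<equiv> free_module R (carrier M \<times> carrier N)"
abbreviation "K \<equiv> tensor_kernel R M N"
abbreviation "T \<equiv> tensor R M N"
abbreviation "pt \<equiv> pure_tensor R M N"

sublocale F: module R F by (rule M.R.free_module_is_module)

lemma gen_closed: "\<lbrakk>x \<in> carrier M; y \<in> carrier N\<rbrakk> \<Longrightarrow> free_gen R (x, y) \<in> carrier F"
  by (rule M.R.free_gen_closed) simp

lemma tensor_relations_closed: "tensor_relations R M N \<subseteq> carrier F"
  unfolding tensor_relations_def Let_def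
  by (auto intro!: gen_closed F.minus_closed F.smult_closed F.a_closed)

lemma K_submodule: "submodule K R F"
  unfolding tensor_kernel_def
  by (intro submodule_module_span F.module_axioms tensor_relations_closed)

sublocale K: abelian_subgroup K F
  by (intro abelian_subgroupI3 additive_subgroup.intro submodule.axioms(1)[OF K_submodule]
      F.abelian_group_axioms)

abbreviation cls where "cls t \<equiv> K +>\<^bsub>F\<^esub> t"

lemma cls_eqI:
  assumes s: "s \<in> carrier F" and t: "t \<in> carrier F" and "s \<ominus>\<^bsub>F\<^esub> t \<in> K"
  shows "cls s = cls t"
  using K.a_rcos_module_rev[OF t s] K.a_repr_independence'[of s t] assms
  by (simp add: a_minus_def)

lemma carrier_tensor: "carrier T = cls ` carrier F"
  by (auto simp: tensor_def Let_def A_RCOSETS_def')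

lemma cls_closed: "t \<in> carrier F \<Longrightarrow> cls t \<in> carrier T"
  by (simp add: carrier_tensor)

lemma tensor_add: "\<lbrakk>s \<in> carrier F; t \<in> carrier F\<rbrakk> \<Longrightarrow> cls s \<oplus>\<^bsub>T\<^esub> cls t = cls (s \<oplus>\<^bsub>F\<^esub> t)"
  by (simp add: tensor_def Let_def K.a_rcos_sum)

lemma tensor_zero: "\<zero>\<^bsub>T\<^esub> = cls \<zero>\<^bsub>F\<^esub>"
  using K.a_subset by (simp add: tensor_def Let_def)

text \<open>Scalar multiplication of cosets is a union over all representatives, which collapses to a single
  coset because the kernel is closed under scalars.\<close>

lemma tensor_smult:
  assumes a: "a \<in> carrier R" and t: "t \<in> carrier F"
  shows "a \<odot>\<^bsub>T\<^esub> cls t = cls (a \<odot>\<^bsub>F\<^esub> t)"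
proof -
  have "cls (a \<odot>\<^bsub>F\<^esub> s) = cls (a \<odot>\<^bsub>F\<^esub> t)" if "s \<in> cls t" for s
  proof (rule cls_eqI)
    have s: "s \<in> carrier F" using K.a_elemrcos_carrier[OF t that] .
    show "a \<odot>\<^bsub>F\<^esub> s \<in> carrier F" "a \<odot>\<^bsub>F\<^esub> t \<in> carrier F" using a s t by auto
    have "a \<odot>\<^bsub>F\<^esub> (s \<oplus>\<^bsub>F\<^esub> \<ominus>\<^bsub>F\<^esub> t) \<in> K"
      using submodule.smult_closed[OF K_submodule a] K.a_rcos_module_imp[OF t that] by simp
    then show "a \<odot>\<^bsub>F\<^esub> s \<ominus>\<^bsub>F\<^esub> a \<odot>\<^bsub>F\<^esub> t \<in> K"
      using a s t by (simp add: a_minus_def F.smult_r_distr F.smult_r_minus)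
  qed
  then have "(\<Union>s\<in>cls t. cls (a \<odot>\<^bsub>F\<^esub> s)) = (\<Union>s\<in>cls t. cls (a \<odot>\<^bsub>F\<^esub> t))"
    by (intro SUP_cong) (rule refl)
  also have "\<dots> = cls (a \<odot>\<^bsub>F\<^esub> t)"
    using K.a_rcos_self[OF t] by blast
  finally show ?thesis by (simp only: tensor_def Let_def module.simps)
qed

lemma tensor_cases:
  assumes "X \<in> carrier T" obtains t where "t \<in> carrier F" "X = cls t"
  using assms by (auto simp: carrier_tensor)

lemma tensor_is_module: "module R T"
proof (rule moduleI)
  show "abelian_group T"
  proof (rule abelian_groupI)
    fix X Y assume "X \<in> carrier T" "Y \<in> carrier T"
    then show "X \<oplus>\<^bsub>T\<^esub> Y \<in> carrier T" "X \<oplus>\<^bsub>T\<^esub> Y = Y \<oplus>\<^bsub>T\<^esub> X"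
      by (auto elim!: tensor_cases simp: tensor_add cls_closed F.a_comm)
  next
    fix X Y Z assume "X \<in> carrier T" "Y \<in> carrier T" "Z \<in> carrier T"
    then show "X \<oplus>\<^bsub>T\<^esub> Y \<oplus>\<^bsub>T\<^esub> Z = X \<oplus>\<^bsub>T\<^esub> (Y \<oplus>\<^bsub>T\<^esub> Z)"
      by (elim tensor_cases) (simp add: tensor_add F.a_assoc)
  next
    fix X assume "X \<in> carrier T"
    then obtain t where t: "t \<in> carrier F" "X = cls t" by (rule tensor_cases)
    then show "\<zero>\<^bsub>T\<^esub> \<oplus>\<^bsub>T\<^esub> X = X"
      by (simp add: tensor_add tensor_zero)
    from t have "cls (\<ominus>\<^bsub>F\<^esub> t) \<oplus>\<^bsub>T\<^esub> X = \<zero>\<^bsub>T\<^esub>"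
      by (simp add: tensor_add tensor_zero F.l_neg)
    with t show "\<exists>Y\<in>carrier T. Y \<oplus>\<^bsub>T\<^esub> X = \<zero>\<^bsub>T\<^esub>"
      by (blast intro: cls_closed F.a_inv_closed)
  qed (simp add: tensor_zero cls_closed)
  show "cring R" by (rule M.R.cring_axioms)
qed (elim tensor_cases, simp add: tensor_add tensor_smult cls_closed
    F.smult_l_distr F.smult_r_distr F.smult_assoc1)+

sublocale T: module R T by (rule tensor_is_module)

lemma pt_cls: "pt x y = cls (free_gen R (x, y))"
  by (simp add: pure_tensor_def)

lemma pure_tensor_bilinear: "pt \<in> bilinear_maps R M N T"
proof -
  let ?e = "free_gen R"
  have rel: "s \<ominus>\<^bsub>F\<^esub> t \<in> K" if "s \<ominus>\<^bsub>F\<^esub> t \<in> tensor_relations R M N" for s t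
    using that module_span_superset[of "tensor_relations R M N" R F]
    by (auto simp: tensor_kernel_def)
  note g = gen_closed
  show ?thesis
  proof (intro bilinear_mapsI linear_mapsI)
    fix x y y' assume xy: "x \<in> carrier M" "y \<in> carrier N" "y' \<in> carrier N"
    have "cls (?e (x, y \<oplus>\<^bsub>N\<^esub> y')) = cls (?e (x, y) \<oplus>\<^bsub>F\<^esub> ?e (x, y'))"
      using xy by (intro cls_eqI rel g F.a_closed) (unfold tensor_relations_def Let_def, blast+)
    then show "pt x (y \<oplus>\<^bsub>N\<^esub> y') = pt x y \<oplus>\<^bsub>T\<^esub> pt x y'"
      using xy by (simp add: pt_cls tensor_add g)
  next
    fix x x' y assume xy: "x \<in> carrier M" "x' \<in> carrier M" "y \<in> carrier N"
    have "cls (?e (x \<oplus>\<^bsub>M\<^esub> x', y)) = cls (?e (x, y) \<oplus>\<^bsub>F\<^esub> ?e (x', y))"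
      using xy by (intro cls_eqI rel g F.a_closed) (unfold tensor_relations_def Let_def, blast+)
    then show "pt (x \<oplus>\<^bsub>M\<^esub> x') y = pt x y \<oplus>\<^bsub>T\<^esub> pt x' y"
      using xy by (simp add: pt_cls tensor_add g)
  next
    fix a x y assume axy: "a \<in> carrier R" "x \<in> carrier M" "y \<in> carrier N"
    have "cls (?e (x, a \<odot>\<^bsub>N\<^esub> y)) = cls (a \<odot>\<^bsub>F\<^esub> ?e (x, y))"
      using axy by (intro cls_eqI rel g F.smult_closed) (unfold tensor_relations_def Let_def, blast+)
    then show "pt x (a \<odot>\<^bsub>N\<^esub> y) = a \<odot>\<^bsub>T\<^esub> pt x y"
      using axy by (simp add: pt_cls tensor_smult g)
    have "cls (?e (a \<odot>\<^bsub>M\<^esub> x, y)) = cls (a \<odot>\<^bsub>F\<^esub> ?e (x, y))"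
      using axy by (intro cls_eqI rel g F.smult_closed) (unfold tensor_relations_def Let_def, blast+)
    then show "pt (a \<odot>\<^bsub>M\<^esub> x) y = a \<odot>\<^bsub>T\<^esub> pt x y"
      using axy by (simp add: pt_cls tensor_smult g)
  qed (auto simp: pt_cls cls_closed g)
qed

lemma pure_tensor_closed: "\<lbrakk>x \<in> carrier M; y \<in> carrier N\<rbrakk> \<Longrightarrow> pt x y \<in> carrier T"
  by (rule bilinear_maps_closed[OF pure_tensor_bilinear])

lemma tensor_induct [consumes 1, case_names pure add]:
  assumes X: "X \<in> carrier T"
    and pure: "\<And>x y. \<lbrakk>x \<in> carrier M; y \<in> carrier N\<rbrakk> \<Longrightarrow> Q (pt x y)"
    and add: "\<And>X Y. \<lbrakk>X \<in> carrier T; Y \<in> carrier T; Q X; Q Y\<rbrakk> \<Longrightarrow> Q (X \<oplus>\<^bsub>T\<^esub> Y)"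
  shows "Q X"
proof -
  have "Q (cls t)" if "t \<in> carrier F" for t
    using that
  proof (induction t rule: M.R.free_module_induct)
    case zero
    have "pt \<zero>\<^bsub>M\<^esub> \<zero>\<^bsub>N\<^esub> = \<zero>\<^bsub>T\<^esub>"
      by (rule linear_maps_zero[OF N.module_axioms tensor_is_module
            bilinear_mapsD(1)[OF pure_tensor_bilinear]]) simp
    with pure[of "\<zero>\<^bsub>M\<^esub>" "\<zero>\<^bsub>N\<^esub>"] show ?case by (simp add: tensor_zero)
  next
    case (step a p t)
    obtain x y where p: "p = (x, y)" "x \<in> carrier M" "y \<in> carrier N"
      using step(2) by auto
    have "cls (a \<odot>\<^bsub>F\<^esub> free_gen R p \<oplus>\<^bsub>F\<^esub> t) = pt (a \<odot>\<^bsub>M\<^esub> x) y \<oplus>\<^bsub>T\<^esub> cls t"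
      using step(1,3) p linear_mapsD(3)[OF bilinear_mapsD(2)[OF pure_tensor_bilinear p(3)] step(1) p(2)]
      by (simp add: pt_cls tensor_add tensor_smult gen_closed)
    with step p show ?case
      by (auto intro!: add pure cls_closed pure_tensor_closed)
  qed
  with X show ?thesis by (auto simp: carrier_tensor)
qed

text \<open>Identities between maps built from \<open>\<Delta>\<close> are checked with this rule, so that no decomposition
  of \<open>\<Delta> x\<close> into pure tensors is ever chosen.\<close>

lemma tensor_maps_eqI:
  assumes "f \<in> linear_maps R T P" "g \<in> linear_maps R T P"
    and "\<And>x y. \<lbrakk>x \<in> carrier M; y \<in> carrier N\<rbrakk> \<Longrightarrow> f (pt x y) = g (pt x y)"
    and "X \<in> carrier T"
  shows "f X = g X"
  using assms(4)
  by (induction X rule: tensor_induct) (simp_all add: assms(3) linear_mapsD[OF assms(1)] linear_mapsD[OF assms(2)])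

text \<open>Each of the four families of relations expresses one clause of bilinearity, so the lift of a
  bilinear map annihilates them and descends to the quotient.\<close>

lemma free_lift_kernel:
  assumes P: "module R P" and \<phi>: "\<phi> \<in> bilinear_maps R M N P"
  shows "K \<subseteq> {t \<in> carrier F. free_lift R P \<phi> t = \<zero>\<^bsub>P\<^esub>}"
proof -
  interpret P: module R P by fact
  let ?L = "free_lift R P \<phi>" and ?e = "free_gen R"
  have L: "?L \<in> linear_maps R F P"
    using bilinear_maps_closed[OF \<phi>] by (intro free_lift_linear[OF P]) auto
  have e: "?L (?e (x, y)) = \<phi> x y" if "x \<in> carrier M" "y \<in> carrier N" for x y
    using bilinear_maps_closed[OF \<phi> that] by (rule free_lift_gen[OF P])
  define Z where "Z = {t \<in> carrier F. ?L t = \<zero>\<^bsub>P\<^esub>}"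
  have diff: "s \<ominus>\<^bsub>F\<^esub> t \<in> Z"
    if "s \<in> carrier F" "t \<in> carrier F" "?L s = ?L t" for s t
  proof -
    have "?L (s \<ominus>\<^bsub>F\<^esub> t) = ?L t \<ominus>\<^bsub>P\<^esub> ?L t"
      using linear_maps_minus[OF F.module_axioms P L that(1,2)] that(3) by simp
    then show ?thesis
      using that linear_mapsD(1)[OF L that(2)] by (simp add: Z_def a_minus_def P.r_neg)
  qed
  note simps = e linear_mapsD(2,3)[OF L] gen_closed
    linear_mapsD(2,3)[OF bilinear_mapsD(1)[OF \<phi>]] linear_mapsD(2,3)[OF bilinear_mapsD(2)[OF \<phi>]]
  have "tensor_relations R M N \<subseteq> Z"
    unfolding tensor_relations_def Let_def Un_subset_iff
    by (intro conjI subsetI; clarify; intro diff) (simp_all add: simps)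
  then show ?thesis
    unfolding tensor_kernel_def Z_def
    by (intro module_span_least submodule_kernel[OF F.module_axioms P L])
qed

lemma tensor_lift_cls:
  assumes P: "module R P" and \<phi>: "\<phi> \<in> bilinear_maps R M N P" and t: "t \<in> carrier F"
  shows "tensor_lift R P \<phi> (cls t) = free_lift R P \<phi> t"
proof -
  interpret P: module R P by fact
  have L: "free_lift R P \<phi> \<in> linear_maps R F P"
    using bilinear_maps_closed[OF \<phi>] by (intro free_lift_linear[OF P]) auto
  have "free_lift R P \<phi> s = free_lift R P \<phi> t" if s: "s \<in> cls t" for s
  proof -
    obtain k where k: "k \<in> K" "s = k \<oplus>\<^bsub>F\<^esub> t" using s by (auto simp: a_r_coset_def r_coset_def)
    have Lk: "k \<in> carrier F" "free_lift R P \<phi> k = \<zero>\<^bsub>P\<^esub>"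
      using subsetD[OF free_lift_kernel[OF P \<phi>] k(1)] by simp_all
    have "free_lift R P \<phi> s = free_lift R P \<phi> k \<oplus>\<^bsub>P\<^esub> free_lift R P \<phi> t"
      unfolding k(2) by (rule linear_mapsD(2)[OF L Lk(1) t])
    also have "\<dots> = free_lift R P \<phi> t"
      unfolding Lk(2) by (rule P.l_zero[OF linear_mapsD(1)[OF L t]])
    finally show ?thesis .
  qed
  then have "free_lift R P \<phi> ` cls t = (\<lambda>_. free_lift R P \<phi> t) ` cls t"
    by (rule image_cong[OF refl])
  also have "\<dots> = {free_lift R P \<phi> t}"
    using K.a_rcos_self[OF t] by (rule image_constant)
  finally show ?thesis by (simp add: tensor_lift_def)
qed

lemma tensor_lift_linear:
  assumes "module R P" and "\<phi> \<in> bilinear_maps R M N P"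
  shows "tensor_lift R P \<phi> \<in> linear_maps R T P"
proof -
  have L: "free_lift R P \<phi> \<in> linear_maps R F P"
    using bilinear_maps_closed[OF assms(2)] by (intro free_lift_linear[OF assms(1)]) auto
  show ?thesis
    by (rule linear_mapsI)
      (auto simp: carrier_tensor tensor_add tensor_smult tensor_lift_cls[OF assms] linear_mapsD[OF L])
qed

lemma tensor_lift_pure:
  assumes "module R P" and "\<phi> \<in> bilinear_maps R M N P" and "x \<in> carrier M" "y \<in> carrier N"
  shows "tensor_lift R P \<phi> (pt x y) = \<phi> x y"
  using assms by (simp add: pt_cls tensor_lift_cls gen_closed free_lift_gen bilinear_maps_closed)

end

context module_pair
begin

text \<open>Iterated lifts, such as the associator and the product of \<open>B \<otimes> B\<close>, are lifts of maps that are
  themselves lifts depending on a parameter. This lemma supplies the bilinearity that the outer lift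
  requires.\<close>

lemma tensor_lift_param_bilinear:
  assumes P: "module R P" and \<phi>: "\<And>z. z \<in> carrier Z \<Longrightarrow> \<phi> z \<in> bilinear_maps R M N P"
    and lin: "\<And>x y. \<lbrakk>x \<in> carrier M; y \<in> carrier N\<rbrakk> \<Longrightarrow> (\<lambda>z. \<phi> z x y) \<in> linear_maps R Z P"
    and Z: "module R Z"
  shows "(\<lambda>X z. tensor_lift R P (\<phi> z) X) \<in> bilinear_maps R T Z P"
proof (rule bilinear_mapsI)
  interpret P: module R P by fact
  interpret Z: module R Z by fact
  show "(\<lambda>X. tensor_lift R P (\<phi> z) X) \<in> linear_maps R T P" if "z \<in> carrier Z" for z
    using tensor_lift_linear[OF P \<phi>[OF that]] .
  note L = linear_mapsD[OF tensor_lift_linear[OF P \<phi>]]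
  fix X assume X: "X \<in> carrier T"
  show "(\<lambda>z. tensor_lift R P (\<phi> z) X) \<in> linear_maps R Z P"
  proof (rule linear_mapsI)
    show "tensor_lift R P (\<phi> z) X \<in> carrier P" if "z \<in> carrier Z" for z
      using L(1) that X by simp
    show "tensor_lift R P (\<phi> (z \<oplus>\<^bsub>Z\<^esub> z')) X =
        tensor_lift R P (\<phi> z) X \<oplus>\<^bsub>P\<^esub> tensor_lift R P (\<phi> z') X"
      if z: "z \<in> carrier Z" "z' \<in> carrier Z" for z z'
      using X
    proof (induction X rule: tensor_induct)
      case (pure x y)
      then show ?case
        using z by (simp add: tensor_lift_pure[OF P \<phi>] linear_mapsD(2)[OF lin])
    next
      case (add X Y)
      then show ?case
        using z L(1) by (simp add: L(2) P.a_ac)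
    qed
    show "tensor_lift R P (\<phi> (a \<odot>\<^bsub>Z\<^esub> z)) X = a \<odot>\<^bsub>P\<^esub> tensor_lift R P (\<phi> z) X"
      if z: "a \<in> carrier R" "z \<in> carrier Z" for a z
      using X
    proof (induction X rule: tensor_induct)
      case (pure x y)
      then show ?case
        using z by (simp add: tensor_lift_pure[OF P \<phi>] linear_mapsD(3)[OF lin])
    next
      case (add X Y)
      then show ?case
        using z L(1) by (simp add: L(2) P.smult_r_distr)
    qed
  qed
qed

lemma
  assumes M': "module R M'" and N': "module R N'"
    and f: "f \<in> linear_maps R M M'" and g: "g \<in> linear_maps R N N'"
  shows tensor_map_linear: "tensor_map R M' N' f g \<in> linear_maps R T (tensor R M' N')"
    and tensor_map_pure: "\<lbrakk>x \<in> carrier M; y \<in> carrier N\<rbrakk> \<Longrightarrow>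
      tensor_map R M' N' f g (pt x y) = pure_tensor R M' N' (f x) (g y)"
proof -
  interpret MN': module_pair R M' N' using M' N' by (rule module_pair.intro)
  note \<phi> = bilinear_maps_compose[OF MN'.pure_tensor_bilinear f g]
  show "tensor_map R M' N' f g \<in> linear_maps R T (tensor R M' N')"
    unfolding tensor_map_def by (rule tensor_lift_linear[OF MN'.tensor_is_module \<phi>])
  show "tensor_map R M' N' f g (pt x y) = pure_tensor R M' N' (f x) (g y)"
    if "x \<in> carrier M" "y \<in> carrier N"
    unfolding tensor_map_def by (rule tensor_lift_pure[OF MN'.tensor_is_module \<phi> that])
qed

end

lemma (in module) id_linear: "(\<lambda>x. x) \<in> linear_maps R M M"
  by (rule linear_mapsI) simp_all

lemma (in module) smult_bilinear: "(\<lambda>a x. a \<odot>\<^bsub>M\<^esub> x) \<in> bilinear_maps R (base_module R) M M"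
  by (intro bilinear_mapsI linear_mapsI)
    (auto simp: smult_l_distr smult_r_distr smult_assoc1 R.m_comm simp flip: smult_assoc1)

lemma (in module) smult_bilinear': "(\<lambda>x a. a \<odot>\<^bsub>M\<^esub> x) \<in> bilinear_maps R M (base_module R) M"
  using smult_bilinear by (auto simp: bilinear_maps_def)


section \<open>The convolution monoid\<close>

context coalgebra
begin

abbreviation "S \<equiv> base_module R"

sublocale CC: module_pair R C C by unfold_locales

lemma S_module: "module R S" by (rule R.base_module_is_module)

text \<open>The linear form \<open>f \<otimes> g\<close> on \<open>C \<otimes> C\<close>.\<close>

definition form_tensor :: "('c \<Rightarrow> 'a) \<Rightarrow> ('c \<Rightarrow> 'a) \<Rightarrow> ('c \<times> 'c \<Rightarrow> 'a) set \<Rightarrow> 'a"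
  where "form_tensor f g = tensor_lift R S (\<lambda>a b. f a \<otimes> g b)"

lemma comult_closed: "x \<in> carrier C \<Longrightarrow> \<Delta> x \<in> carrier CC.T"
  by (rule linear_mapsD(1)[OF comult_linear])

context
  fixes f g assumes f: "f \<in> linear_maps R C S" and g: "g \<in> linear_maps R C S"
begin

lemma form_tensor_linear: "form_tensor f g \<in> linear_maps R CC.T S"
  unfolding form_tensor_def
  by (rule CC.tensor_lift_linear[OF S_module bilinear_maps_compose[OF R.mult_bilinear f g]])

lemma form_tensor_pure:
  "\<lbrakk>x \<in> carrier C; y \<in> carrier C\<rbrakk> \<Longrightarrow> form_tensor f g (CC.pt x y) = f x \<otimes> g y"
  unfolding form_tensor_def
  by (rule CC.tensor_lift_pure[OF S_module bilinear_maps_compose[OF R.mult_bilinear f g]])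

lemma convolution_eq:
  assumes "x \<in> carrier C"
  shows "convolution R C \<Delta> f g x = form_tensor f g (\<Delta> x)"
proof -
  interpret SS: module_pair R S S by (intro module_pair.intro S_module)
  have "tensor_lift R S (\<lambda>a b. a \<otimes> b) (tensor_map R S S f g (\<Delta> x)) = form_tensor f g (\<Delta> x)"
  proof (rule CC.tensor_maps_eqI[OF _ form_tensor_linear _ comult_closed[OF assms]])
    show "(\<lambda>X. tensor_lift R S (\<lambda>a b. a \<otimes> b) (tensor_map R S S f g X)) \<in> linear_maps R CC.T S"
      by (rule linear_maps_compose[OF CC.tensor_map_linear[OF S_module S_module f g]
            SS.tensor_lift_linear[OF S_module R.mult_bilinear]])
    show "tensor_lift R S (\<lambda>a b. a \<otimes> b) (tensor_map R S S f g (CC.pt x y)) =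
        form_tensor f g (CC.pt x y)" if "x \<in> carrier C" "y \<in> carrier C" for x y
      using that linear_mapsD(1)[OF f] linear_mapsD(1)[OF g]
      by (simp add: CC.tensor_map_pure[OF S_module S_module f g] form_tensor_pure
          SS.tensor_lift_pure[OF S_module R.mult_bilinear])
  qed
  then show ?thesis using assms by (simp add: convolution_def)
qed

lemma convolution_linear: "convolution R C \<Delta> f g \<in> linear_maps R C S"
proof -
  have "(\<lambda>x. form_tensor f g (\<Delta> x)) \<in> linear_maps R C S"
    by (rule linear_maps_compose[OF comult_linear form_tensor_linear])
  then show ?thesis
    by (auto simp: linear_maps_def convolution_eq)
qed

end

lemma convolution_extensional: "convolution R C \<Delta> f g \<in> extensional (carrier C)"
  by (simp add: convolution_def)

text \<open>The trilinear form \<open>f \<otimes> g \<otimes> h\<close> exists on \<open>(C \<otimes> C) \<otimes> C\<close> (as \<open>\<Phi>\<close>) and on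
  \<open>C \<otimes> (C \<otimes> C)\<close> (as \<open>\<Psi>\<close>), and the associator carries one to the other. The two bracketings
  of the convolution evaluate these forms on the two sides of the coassociativity axiom.\<close>

lemma convolution_assoc:
  assumes f: "f \<in> linear_maps R C S" and g: "g \<in> linear_maps R C S" and h: "h \<in> linear_maps R C S"
  shows "convolution R C \<Delta> (convolution R C \<Delta> f g) h =
    convolution R C \<Delta> f (convolution R C \<Delta> g h)"
proof (rule extensionalityI[OF convolution_extensional convolution_extensional])
  fix x assume x: "x \<in> carrier C"
  let ?T1 = "tensor R CC.T C" and ?T2 = "tensor R C CC.T"
  interpret L: module_pair R CC.T C by unfold_locales
  interpret Q: module_pair R C CC.T by unfold_locales
  define \<Phi> where "\<Phi> = tensor_lift R S (\<lambda>X z. form_tensor f g X \<otimes> h z)"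
  define \<Psi> where "\<Psi> = tensor_lift R S (\<lambda>x Y. f x \<otimes> form_tensor g h Y)"
  note b1 = bilinear_maps_compose[OF R.mult_bilinear form_tensor_linear[OF f g] h]
  note b2 = bilinear_maps_compose[OF R.mult_bilinear f form_tensor_linear[OF g h]]
  have \<Phi>: "\<Phi> \<in> linear_maps R ?T1 S"
    unfolding \<Phi>_def by (rule L.tensor_lift_linear[OF S_module b1])
  have \<Phi>_pure: "\<Phi> (L.pt X z) = form_tensor f g X \<otimes> h z" if "X \<in> carrier CC.T" "z \<in> carrier C" for X z
    unfolding \<Phi>_def by (rule L.tensor_lift_pure[OF S_module b1 that])
  have \<Psi>: "\<Psi> \<in> linear_maps R ?T2 S"
    unfolding \<Psi>_def by (rule Q.tensor_lift_linear[OF S_module b2])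
  have \<Psi>_pure: "\<Psi> (Q.pt x Y) = f x \<otimes> form_tensor g h Y" if "x \<in> carrier C" "Y \<in> carrier CC.T" for x Y
    unfolding \<Psi>_def by (rule Q.tensor_lift_pure[OF S_module b2 that])
  note id = id_linear
  let ?l = "tensor_map R CC.T C \<Delta> (\<lambda>c. c)" and ?r = "tensor_map R C CC.T (\<lambda>c. c) \<Delta>"
  note l = CC.tensor_map_linear[OF CC.tensor_is_module module_axioms comult_linear id]
  note r = CC.tensor_map_linear[OF module_axioms CC.tensor_is_module id comult_linear]
  note lp = CC.tensor_map_pure[OF CC.tensor_is_module module_axioms comult_linear id]
  note rp = CC.tensor_map_pure[OF module_axioms CC.tensor_is_module id comult_linear]
  have left: "convolution R C \<Delta> (convolution R C \<Delta> f g) h x = \<Phi> (?l (\<Delta> x))"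
    unfolding convolution_eq[OF convolution_linear[OF f g] h x]
  proof (rule CC.tensor_maps_eqI[OF form_tensor_linear[OF convolution_linear[OF f g] h]
        linear_maps_compose[OF l \<Phi>] _ comult_closed[OF x]])
    fix a b assume "a \<in> carrier C" "b \<in> carrier C"
    then show "form_tensor (convolution R C \<Delta> f g) h (CC.pt a b) = \<Phi> (?l (CC.pt a b))"
      by (simp add: lp \<Phi>_pure comult_closed form_tensor_pure[OF convolution_linear[OF f g] h]
          convolution_eq[OF f g])
  qed
  have right: "convolution R C \<Delta> f (convolution R C \<Delta> g h) x = \<Psi> (?r (\<Delta> x))"
    unfolding convolution_eq[OF f convolution_linear[OF g h] x]
  proof (rule CC.tensor_maps_eqI[OF form_tensor_linear[OF f convolution_linear[OF g h]]
        linear_maps_compose[OF r \<Psi>] _ comult_closed[OF x]])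
    fix a b assume "a \<in> carrier C" "b \<in> carrier C"
    then show "form_tensor f (convolution R C \<Delta> g h) (CC.pt a b) = \<Psi> (?r (CC.pt a b))"
      by (simp add: rp \<Psi>_pure comult_closed form_tensor_pure[OF f convolution_linear[OF g h]]
          convolution_eq[OF g h])
  qed
  have b3: "(\<lambda>x y. Q.pt x (CC.pt y z)) \<in> bilinear_maps R C C ?T2" if "z \<in> carrier C" for z
    by (rule bilinear_maps_compose[OF Q.pure_tensor_bilinear id
          bilinear_mapsD(2)[OF CC.pure_tensor_bilinear that]])
  have b4: "(\<lambda>X z. tensor_lift R ?T2 (\<lambda>x y. Q.pt x (CC.pt y z)) X) \<in> bilinear_maps R CC.T C ?T2"
    by (rule CC.tensor_lift_param_bilinear[OF Q.tensor_is_module b3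
          linear_maps_compose[OF bilinear_mapsD(1)[OF CC.pure_tensor_bilinear]
            bilinear_mapsD(1)[OF Q.pure_tensor_bilinear]] module_axioms])
  have a: "tensor_assoc R C C C \<in> linear_maps R ?T1 ?T2"
    unfolding tensor_assoc_def by (rule L.tensor_lift_linear[OF Q.tensor_is_module b4])
  have "\<Psi> (tensor_assoc R C C C W) = \<Phi> W" if W: "W \<in> carrier ?T1" for W
  proof (rule L.tensor_maps_eqI[OF linear_maps_compose[OF a \<Psi>] \<Phi> _ W])
    fix X z assume X: "X \<in> carrier CC.T" and z: "z \<in> carrier C"
    have "\<Psi> (tensor_assoc R C C C (L.pt X z)) =
        \<Psi> (tensor_lift R ?T2 (\<lambda>x y. Q.pt x (CC.pt y z)) X)"
      unfolding tensor_assoc_def by (simp add: L.tensor_lift_pure[OF Q.tensor_is_module b4 X z])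
    also have "\<dots> = \<Phi> (L.pt X z)"
    proof (rule CC.tensor_maps_eqI[OF
          linear_maps_compose[OF CC.tensor_lift_linear[OF Q.tensor_is_module b3[OF z]] \<Psi>]
          linear_maps_compose[OF bilinear_mapsD(2)[OF L.pure_tensor_bilinear z] \<Phi>] _ X])
      fix x y assume "x \<in> carrier C" "y \<in> carrier C"
      then show "\<Psi> (tensor_lift R ?T2 (\<lambda>x y. Q.pt x (CC.pt y z)) (CC.pt x y)) = \<Phi> (L.pt (CC.pt x y) z)"
        using z linear_mapsD(1)[OF f] linear_mapsD(1)[OF g] linear_mapsD(1)[OF h]
        by (simp add: CC.tensor_lift_pure[OF Q.tensor_is_module b3] \<Psi>_pure \<Phi>_pure
            CC.pure_tensor_closed form_tensor_pure f g h R.m_assoc)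
    qed
    finally show "\<Psi> (tensor_assoc R C C C (L.pt X z)) = \<Phi> (L.pt X z)" .
  qed
  from this[of "?l (\<Delta> x)"] show "convolution R C \<Delta> (convolution R C \<Delta> f g) h x =
      convolution R C \<Delta> f (convolution R C \<Delta> g h) x"
    using x by (simp add: left right coassoc linear_mapsD(1)[OF l] comult_closed)
qed

text \<open>The unit \<open>e\<close> is only required to agree with \<open>\<epsilon>\<close> on the carrier, since the unit of the dual
  algebra is \<open>\<epsilon>\<close> made extensional.\<close>

lemma convolution_unit:
  assumes f: "f \<in> linear_maps R C S" and e: "e \<in> linear_maps R C S"
    and eq: "\<And>x. x \<in> carrier C \<Longrightarrow> e x = \<epsilon> x" and x: "x \<in> carrier C"
  shows "convolution R C \<Delta> e f x = f x" and "convolution R C \<Delta> f e x = f x"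
proof -
  interpret SC: module_pair R S C by (intro module_pair.intro S_module module_axioms)
  interpret CS: module_pair R C S by (intro module_pair.intro S_module module_axioms)
  note id = id_linear
  note l = CC.tensor_map_linear[OF S_module module_axioms counit_linear id]
  note r = CC.tensor_map_linear[OF module_axioms S_module id counit_linear]
  note closed = linear_mapsD(1)[OF counit_linear, simplified] linear_mapsD(1)[OF f, simplified]
  have "form_tensor e f (\<Delta> x) =
      f (tensor_lift R C (\<lambda>a c. a \<odot>\<^bsub>C\<^esub> c) (tensor_map R S C \<epsilon> (\<lambda>c. c) (\<Delta> x)))"
  proof (rule CC.tensor_maps_eqI[OF form_tensor_linear[OF e f] linear_maps_compose[OF linear_maps_compose[OF l
            SC.tensor_lift_linear[OF module_axioms smult_bilinear]] f] _ comult_closed[OF x]])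
    fix a b assume "a \<in> carrier C" "b \<in> carrier C"
    then show "form_tensor e f (CC.pt a b) =
        f (tensor_lift R C (\<lambda>a c. a \<odot>\<^bsub>C\<^esub> c) (tensor_map R S C \<epsilon> (\<lambda>c. c) (CC.pt a b)))"
      by (simp add: form_tensor_pure[OF e f] CC.tensor_map_pure[OF S_module module_axioms counit_linear id]
          SC.tensor_lift_pure[OF module_axioms smult_bilinear] closed linear_mapsD(3)[OF f] eq)
  qed
  then show "convolution R C \<Delta> e f x = f x"
    using x by (simp add: convolution_eq[OF e f] counit_left)
  have "form_tensor f e (\<Delta> x) =
      f (tensor_lift R C (\<lambda>c a. a \<odot>\<^bsub>C\<^esub> c) (tensor_map R C S (\<lambda>c. c) \<epsilon> (\<Delta> x)))"
  proof (rule CC.tensor_maps_eqI[OF form_tensor_linear[OF f e] linear_maps_compose[OF linear_maps_compose[OF r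
            CS.tensor_lift_linear[OF module_axioms smult_bilinear']] f] _ comult_closed[OF x]])
    fix a b assume "a \<in> carrier C" "b \<in> carrier C"
    then show "form_tensor f e (CC.pt a b) =
        f (tensor_lift R C (\<lambda>c a. a \<odot>\<^bsub>C\<^esub> c) (tensor_map R C S (\<lambda>c. c) \<epsilon> (CC.pt a b)))"
      by (simp add: form_tensor_pure[OF f e] CC.tensor_map_pure[OF module_axioms S_module id counit_linear]
          CS.tensor_lift_pure[OF module_axioms smult_bilinear'] closed linear_mapsD(3)[OF f] eq R.m_comm)
  qed
  then show "convolution R C \<Delta> f e x = f x"
    using x by (simp add: convolution_eq[OF f e] counit_right)
qed

lemma convolution_zero_left:
  assumes f: "f \<in> linear_maps R C S" and g: "g \<in> linear_maps R C S"
    and zero: "\<And>x. x \<in> carrier C \<Longrightarrow> f x = \<zero>" and x: "x \<in> carrier C"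
  shows "convolution R C \<Delta> f g x = \<zero>"
proof -
  have "form_tensor f g X = \<zero>" if "X \<in> carrier CC.T" for X
    using that
    by (induction X rule: CC.tensor_induct)
      (use linear_mapsD[OF form_tensor_linear[OF f g]] linear_mapsD(1)[OF g] in
        \<open>simp_all add: form_tensor_pure f g zero\<close>)
  with x show ?thesis by (simp add: convolution_eq f g comult_closed)
qed

abbreviation "dual \<equiv> dual_algebra R C \<Delta> \<epsilon>"

lemma dual_simps:
  "carrier dual = linear_maps R C S \<inter> extensional (carrier C)"
  "mult dual = convolution R C \<Delta>"
  "one dual = restrict \<epsilon> (carrier C)"
  "zero dual = (\<lambda>x\<in>carrier C. \<zero>)"
  "add dual = (\<lambda>f g. \<lambda>x\<in>carrier C. f x \<oplus> g x)"
  "smult dual = (\<lambda>a f. \<lambda>x\<in>carrier C. a \<otimes> f x)"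
  by (simp_all add: dual_algebra_def)

lemma restrict_linear:
  "f \<in> linear_maps R C S \<Longrightarrow> restrict f (carrier C) \<in> linear_maps R C S"
  by (auto simp: linear_maps_def)

lemma dual_is_module: "module R dual"
proof -
  have closed: "f x \<in> carrier R" if "f \<in> carrier dual" "x \<in> carrier C" for f x
    using that linear_mapsD(1)[of f R C S] by (simp add: dual_simps)
  have smult: "a \<odot>\<^bsub>dual\<^esub> f \<in> carrier dual" if "a \<in> carrier R" "f \<in> carrier dual" for a f
    using that by (auto simp: dual_simps linear_maps_def R.r_distr R.m_lcomm Pi_def)
  have eqI: "f = g" if "f \<in> extensional (carrier C)" "g \<in> extensional (carrier C)"
    "\<And>x. x \<in> carrier C \<Longrightarrow> f x = g x" for f g :: "'c \<Rightarrow> 'a"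
    using that by (rule extensionalityI)
  show ?thesis
  proof (rule moduleI)
    show "abelian_group dual"
    proof (rule abelian_groupI)
      fix f assume f: "f \<in> carrier dual"
      have "(\<ominus> \<one>) \<odot>\<^bsub>dual\<^esub> f \<oplus>\<^bsub>dual\<^esub> f = \<zero>\<^bsub>dual\<^esub>"
        using closed[OF f] by (auto simp: dual_simps R.l_minus R.l_neg intro!: restrict_ext)
      then show "\<exists>g\<in>carrier dual. g \<oplus>\<^bsub>dual\<^esub> f = \<zero>\<^bsub>dual\<^esub>"
        using smult[OF _ f, of "\<ominus> \<one>"] by auto
      show "\<zero>\<^bsub>dual\<^esub> \<oplus>\<^bsub>dual\<^esub> f = f"
        using closed[OF f] f by (intro eqI) (auto simp: dual_simps)
    next
      fix f g assume fg: "f \<in> carrier dual" "g \<in> carrier dual"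
      then show "f \<oplus>\<^bsub>dual\<^esub> g \<in> carrier dual"
        by (auto simp: dual_simps linear_maps_def R.r_distr R.a_ac Pi_def)
      show "f \<oplus>\<^bsub>dual\<^esub> g = g \<oplus>\<^bsub>dual\<^esub> f"
        using fg closed by (auto simp: dual_simps R.a_comm intro!: restrict_ext)
    next
      fix f g h assume "f \<in> carrier dual" "g \<in> carrier dual" "h \<in> carrier dual"
      then show "f \<oplus>\<^bsub>dual\<^esub> g \<oplus>\<^bsub>dual\<^esub> h = f \<oplus>\<^bsub>dual\<^esub> (g \<oplus>\<^bsub>dual\<^esub> h)"
        using closed[of f] closed[of g] closed[of h]
        by (auto simp: dual_simps R.a_assoc intro!: restrict_ext)
    qed (auto simp: dual_simps linear_maps_def)
    fix a f assume af: "a \<in> carrier R" "f \<in> carrier dual"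
    show "a \<odot>\<^bsub>dual\<^esub> f \<in> carrier dual" by (rule smult[OF af])
    show "(a \<oplus> b) \<odot>\<^bsub>dual\<^esub> f = a \<odot>\<^bsub>dual\<^esub> f \<oplus>\<^bsub>dual\<^esub> b \<odot>\<^bsub>dual\<^esub> f"
      "(a \<otimes> b) \<odot>\<^bsub>dual\<^esub> f = a \<odot>\<^bsub>dual\<^esub> (b \<odot>\<^bsub>dual\<^esub> f)" if "b \<in> carrier R" for b
      using af that closed[of f]
      by (auto simp: dual_simps R.l_distr R.m_assoc intro!: restrict_ext)
    show "a \<odot>\<^bsub>dual\<^esub> (f \<oplus>\<^bsub>dual\<^esub> g) = a \<odot>\<^bsub>dual\<^esub> f \<oplus>\<^bsub>dual\<^esub> a \<odot>\<^bsub>dual\<^esub> g"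
      if "g \<in> carrier dual" for g
      using af that closed[of f] closed[of g]
      by (auto simp: dual_simps R.r_distr intro!: restrict_ext)
  next
    fix f assume "f \<in> carrier dual"
    then show "\<one> \<odot>\<^bsub>dual\<^esub> f = f"
      using closed[of f] by (intro eqI) (auto simp: dual_simps)
  qed (rule R.cring_axioms)
qed

sublocale D: module R dual by (rule dual_is_module)

lemma dual_evaluation_linear: "x \<in> carrier C \<Longrightarrow> (\<lambda>f. f x) \<in> linear_maps R dual S"
  by (rule linear_mapsI) (auto simp: dual_simps linear_maps_def)

lemma dual_eqI:
  "\<lbrakk>f \<in> carrier dual; g \<in> carrier dual; \<And>x. x \<in> carrier C \<Longrightarrow> f x = g x\<rbrakk> \<Longrightarrow> f = g"
  by (rule extensionalityI[of _ "carrier C"]) (auto simp: dual_simps)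

lemma dual_mult_closed:
  "\<lbrakk>f \<in> carrier dual; g \<in> carrier dual\<rbrakk> \<Longrightarrow> f \<otimes>\<^bsub>dual\<^esub> g \<in> carrier dual"
  by (simp add: dual_simps convolution_linear convolution_extensional)

lemma dual_one_closed: "\<one>\<^bsub>dual\<^esub> \<in> carrier dual"
  using restrict_linear[OF counit_linear] by (simp add: dual_simps)

end

section \<open>Powers of two-sided ideals\<close>

context assoc_algebra
begin

text \<open>Closure under scalars comes from the unit: \<open>a u = (a 1) u\<close>.\<close>

lemma ideal_imp_submodule:
  assumes "ideal U A"
  shows "submodule U R A"
proof -
  interpret U: ideal U A by fact
  show ?thesis
  proof (rule submoduleI)
    fix a u assume a: "a \<in> carrier R" and u: "u \<in> U"
    then have "a \<odot>\<^bsub>A\<^esub> u = (a \<odot>\<^bsub>A\<^esub> \<one>\<^bsub>A\<^esub>) \<otimes>\<^bsub>A\<^esub> u"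
      using U.a_subset by (simp add: smult_mult_left subset_iff)
    then show "a \<odot>\<^bsub>A\<^esub> u \<in> U"
      using a u by (simp add: U.I_l_closed)
  qed (use U.a_subset in auto)
qed

lemma left_mult_linear: "x \<in> carrier A \<Longrightarrow> (\<lambda>y. x \<otimes>\<^bsub>A\<^esub> y) \<in> linear_maps R A A"
  by (rule linear_mapsI) (simp_all add: A.r_distr smult_mult_right)

lemma right_mult_linear: "y \<in> carrier A \<Longrightarrow> (\<lambda>x. x \<otimes>\<^bsub>A\<^esub> y) \<in> linear_maps R A A"
  by (rule linear_mapsI) (simp_all add: A.l_distr smult_mult_left)

context
  fixes U assumes U: "ideal U A"
begin

interpretation U: ideal U A by (rule U)

abbreviation pow_U where "pow_U \<equiv> submodule_power R A U"

text \<open>The case of exponent zero is separate in all inductions on powers: the power with exponent one is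
  \<open>U\<close> itself and not the product of the whole algebra with \<open>U\<close>.\<close>

lemma submodule_power_submodule: "submodule (pow_U n) R A"
proof (cases n)
  case (Suc m)
  have "submodule (pow_U (Suc m)) R A"
  proof (induction m)
    case (Suc m)
    then show ?case
      using submoduleE(1)[OF Suc] U.a_subset
      by (simp del: submodule_power.simps(2) add: submodule_prod_def)
        (intro submodule_module_span module_axioms, auto)
  qed (simp add: ideal_imp_submodule U)
  with Suc show ?thesis by simp
qed (simp add: carrier_is_submodule)

lemmas submodule_power_closed = subsetD[OF submoduleE(1)[OF submodule_power_submodule]]

lemma submodule_power_mult_ideal:
  assumes "x \<in> pow_U n" and "u \<in> U"
  shows "x \<otimes>\<^bsub>A\<^esub> u \<in> pow_U (Suc n)"
proof (cases n)
  case 0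
  with assms show ?thesis by (simp add: U.I_l_closed)
next
  case (Suc m)
  with assms show ?thesis
    unfolding Suc submodule_power.simps(3) submodule_prod_def
    by (intro subsetD[OF module_span_superset]) blast
qed

text \<open>Membership in a power is tested on the generating products, provided the property cuts out a
  submodule.\<close>

lemma submodule_power_Suc_Suc_least:
  assumes "submodule H R A" and "\<And>x u. \<lbrakk>x \<in> pow_U (Suc n); u \<in> U\<rbrakk> \<Longrightarrow> x \<otimes>\<^bsub>A\<^esub> u \<in> H"
  shows "pow_U (Suc (Suc n)) \<subseteq> H"
  unfolding submodule_power.simps(3) submodule_prod_def
  using assms by (intro module_span_least) auto

lemma submodule_power_l_closed:
  assumes b: "b \<in> carrier A"
  shows "x \<in> pow_U n \<Longrightarrow> b \<otimes>\<^bsub>A\<^esub> x \<in> pow_U n"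
proof (cases n)
  case (Suc m)
  have "pow_U (Suc m) \<subseteq> {x \<in> carrier A. b \<otimes>\<^bsub>A\<^esub> x \<in> pow_U (Suc m)}"
  proof (induction m)
    case 0
    then show ?case using b U.a_subset by (auto simp: U.I_l_closed)
  next
    case (Suc m)
    show ?case
    proof (rule submodule_power_Suc_Suc_least)
      show "submodule {x \<in> carrier A. b \<otimes>\<^bsub>A\<^esub> x \<in> pow_U (Suc (Suc m))} R A"
        by (rule submodule_vimage[OF module_axioms module_axioms left_mult_linear[OF b]
              submodule_power_submodule])
      fix x u assume x: "x \<in> pow_U (Suc m)" and u: "u \<in> U"
      have "(b \<otimes>\<^bsub>A\<^esub> x) \<otimes>\<^bsub>A\<^esub> u \<in> pow_U (Suc (Suc m))"
        by (rule submodule_power_mult_ideal) (use Suc x u in auto)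
      then show "x \<otimes>\<^bsub>A\<^esub> u \<in> {x \<in> carrier A. b \<otimes>\<^bsub>A\<^esub> x \<in> pow_U (Suc (Suc m))}"
        using b u submodule_power_closed[OF x] by (simp add: A.m_assoc)
    qed
  qed
  then show "x \<in> pow_U n \<Longrightarrow> b \<otimes>\<^bsub>A\<^esub> x \<in> pow_U n" unfolding Suc by blast
qed (use b in simp)

lemma submodule_power_r_closed:
  assumes b: "b \<in> carrier A"
  shows "x \<in> pow_U n \<Longrightarrow> x \<otimes>\<^bsub>A\<^esub> b \<in> pow_U n"
proof (cases n)
  case (Suc m)
  have "pow_U (Suc m) \<subseteq> {x \<in> carrier A. x \<otimes>\<^bsub>A\<^esub> b \<in> pow_U (Suc m)}"
  proof (induction m)
    case 0
    then show ?case using b U.a_subset by (auto simp: U.I_r_closed)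
  next
    case (Suc m)
    show ?case
    proof (rule submodule_power_Suc_Suc_least)
      show "submodule {x \<in> carrier A. x \<otimes>\<^bsub>A\<^esub> b \<in> pow_U (Suc (Suc m))} R A"
        by (rule submodule_vimage[OF module_axioms module_axioms right_mult_linear[OF b]
              submodule_power_submodule])
      fix x u assume x: "x \<in> pow_U (Suc m)" and u: "u \<in> U"
      have "x \<otimes>\<^bsub>A\<^esub> (u \<otimes>\<^bsub>A\<^esub> b) \<in> pow_U (Suc (Suc m))"
        using x u b by (intro submodule_power_mult_ideal U.I_r_closed)
      then show "x \<otimes>\<^bsub>A\<^esub> u \<in> {x \<in> carrier A. x \<otimes>\<^bsub>A\<^esub> b \<in> pow_U (Suc (Suc m))}"
        using b u submodule_power_closed[OF x] by (simp add: A.m_assoc)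
    qed
  qed
  then show "x \<in> pow_U n \<Longrightarrow> x \<otimes>\<^bsub>A\<^esub> b \<in> pow_U n" unfolding Suc by blast
qed (use b in simp)

lemma submodule_power_antimono:
  assumes "m \<le> n"
  shows "pow_U n \<subseteq> pow_U m"
proof (rule lift_Suc_antimono_le[OF _ assms])
  fix k
  show "pow_U (Suc k) \<subseteq> pow_U k"
  proof (cases k)
    case (Suc l)
    show ?thesis
      unfolding Suc
      by (rule submodule_power_Suc_Suc_least[OF submodule_power_submodule submodule_power_r_closed])
        (use U.a_subset in auto)
  qed (use U.a_subset in simp)
qed

lemma submodule_power_mult:
  assumes x: "x \<in> pow_U m" and y: "y \<in> pow_U n"
  shows "x \<otimes>\<^bsub>A\<^esub> y \<in> pow_U (m + n)"
proof (cases n)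
  case 0
  with x y show ?thesis by (simp add: submodule_power_r_closed)
next
  case (Suc k)
  have xA: "x \<in> carrier A" using submodule_power_closed[OF x] .
  have "pow_U (Suc k) \<subseteq> {y \<in> carrier A. x \<otimes>\<^bsub>A\<^esub> y \<in> pow_U (m + Suc k)}"
  proof (induction k)
    case 0
    then show ?case using x U.a_subset submodule_power_mult_ideal[OF x] by auto
  next
    case (Suc k)
    show ?case
    proof (rule submodule_power_Suc_Suc_least)
      show "submodule {y \<in> carrier A. x \<otimes>\<^bsub>A\<^esub> y \<in> pow_U (m + Suc (Suc k))} R A"
        by (rule submodule_vimage[OF module_axioms module_axioms left_mult_linear[OF xA]
              submodule_power_submodule])
      fix y u assume y: "y \<in> pow_U (Suc k)" and u: "u \<in> U"
      have "(x \<otimes>\<^bsub>A\<^esub> y) \<otimes>\<^bsub>A\<^esub> u \<in> pow_U (Suc (m + Suc k))"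
        by (rule submodule_power_mult_ideal) (use Suc y u in auto)
      then show "y \<otimes>\<^bsub>A\<^esub> u \<in> {y \<in> carrier A. x \<otimes>\<^bsub>A\<^esub> y \<in> pow_U (m + Suc (Suc k))}"
        using xA u submodule_power_closed[OF y] by (simp add: A.m_assoc)
    qed
  qed
  with y Suc show ?thesis by blast
qed

lemma nat_pow_mem_submodule_power:
  assumes "u \<in> U"
  shows "u [^]\<^bsub>A\<^esub> (n::nat) \<in> pow_U n"
  by (induction n) (use assms in \<open>simp_all add: submodule_power_mult_ideal\<close>)

end


section \<open>Independence of generalized eigenfunctionals\<close>

lemma algebra_homsD:
  assumes "\<chi> \<in> algebra_homs R A (base_module R)"
  shows "\<chi> \<in> linear_maps R A (base_module R)" and "\<chi> \<in> ring_hom A R"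
    and "x \<in> carrier A \<Longrightarrow> \<chi> x \<in> carrier R"
    and "\<lbrakk>x \<in> carrier A; y \<in> carrier A\<rbrakk> \<Longrightarrow> \<chi> (x \<otimes>\<^bsub>A\<^esub> y) = \<chi> x \<otimes> \<chi> y"
    and "\<chi> \<one>\<^bsub>A\<^esub> = \<one>"
  using assms by (auto simp: algebra_homs_def ring_hom_def)

lemma character_ring_hom_ring:
  "\<chi> \<in> algebra_homs R A (base_module R) \<Longrightarrow> ring_hom_ring A R \<chi>"
  by (intro ring_hom_ring.intro ring_hom_ring_axioms.intro A.ring_axioms R.ring_axioms algebra_homsD(2))

lemma character_kernel_ideal:
  "\<chi> \<in> algebra_homs R A (base_module R) \<Longrightarrow> ideal (a_kernel A R \<chi>) A"
  by (rule ring_hom_ring.kernel_is_ideal[OF character_ring_hom_ring])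

lemma character_kernel_iff: "x \<in> a_kernel A R \<chi> \<longleftrightarrow> x \<in> carrier A \<and> \<chi> x = \<zero>"
  by (auto simp: a_kernel_def')

lemma character_minus_scalar:
  assumes "\<chi> \<in> algebra_homs R A (base_module R)" "x \<in> carrier A" "c \<in> carrier R"
  shows "\<chi> (x \<ominus>\<^bsub>A\<^esub> c \<odot>\<^bsub>A\<^esub> \<one>\<^bsub>A\<^esub>) = \<chi> x \<ominus> c"
  using assms algebra_homsD[OF assms(1)]
  by (simp add: linear_maps_minus[OF module_axioms R.base_module_is_module]
      linear_mapsD(3)[OF algebra_homsD(1)[OF assms(1)]])

lemma minus_character_in_kernel:
  assumes "\<chi> \<in> algebra_homs R A (base_module R)" "x \<in> carrier A"
  shows "x \<ominus>\<^bsub>A\<^esub> \<chi> x \<odot>\<^bsub>A\<^esub> \<one>\<^bsub>A\<^esub> \<in> a_kernel A R \<chi>"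
  using assms algebra_homsD(3)[OF assms(1)]
  by (simp add: character_kernel_iff character_minus_scalar)

context
  fixes I :: "'i set" and \<chi> h and N :: "'i \<Rightarrow> nat"
  assumes dom: "domain R" and fin: "finite I"
    and \<chi>: "\<And>i. i \<in> I \<Longrightarrow> \<chi> i \<in> algebra_homs R A (base_module R)"
    and distinct: "\<And>i j. \<lbrakk>i \<in> I; j \<in> I; i \<noteq> j\<rbrakk> \<Longrightarrow> \<exists>x\<in>carrier A. \<chi> i x \<noteq> \<chi> j x"
    and h: "\<And>i. i \<in> I \<Longrightarrow> h i \<in> linear_maps R A (base_module R)"
    and vanish: "\<And>i x. \<lbrakk>i \<in> I; x \<in> submodule_power R A (a_kernel A R (\<chi> i)) (N i)\<rbrakk> \<Longrightarrow> h i x = \<zero>"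
    and sum_zero: "\<And>x. x \<in> carrier A \<Longrightarrow> (\<Oplus>i\<in>I. h i x) = \<zero>"
begin

interpretation dom: domain R by (rule dom)

text \<open>For each \<open>j\<close> some \<open>y\<close> has \<open>\<chi>\<^sub>i y \<noteq> \<chi>\<^sub>j y\<close>, so \<open>w = y - \<chi>\<^sub>j(y) 1\<close> lies in
  \<open>ker \<chi>\<^sub>j\<close> but not in \<open>ker \<chi>\<^sub>i\<close>. The product of suitable powers of these \<open>w\<close> is the element
  wanted: powers of ideals are two-sided, and \<open>\<chi>\<^sub>i\<close> of the product is nonzero in a domain.\<close>

lemma separating_element:
  assumes i: "i \<in> I" and J: "J \<subseteq> I - {i}"
  shows "\<exists>z\<in>carrier A. \<chi> i z \<noteq> \<zero> \<and>
    (\<forall>j\<in>J. z \<in> submodule_power R A (a_kernel A R (\<chi> j)) (N j))"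
  using finite_subset[OF J finite_Diff[OF fin]] J
proof (induction J rule: finite_induct)
  case empty
  then show ?case using algebra_homsD(5)[OF \<chi>[OF i]] by (intro bexI[of _ "\<one>\<^bsub>A\<^esub>"]) auto
next
  case (insert j J)
  note \<chi>i = algebra_homsD[OF \<chi>[OF i]]
  obtain z where z: "z \<in> carrier A" "\<chi> i z \<noteq> \<zero>"
    "\<And>k. k \<in> J \<Longrightarrow> z \<in> submodule_power R A (a_kernel A R (\<chi> k)) (N k)"
    using insert by auto
  have j: "j \<in> I" "i \<noteq> j" using insert.prems by auto
  note \<chi>j = algebra_homsD[OF \<chi>[OF j(1)]]
  note ker = character_kernel_ideal[OF \<chi>]
  obtain y where y: "y \<in> carrier A" "\<chi> i y \<noteq> \<chi> j y" using distinct[OF i j] by blast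
  let ?w = "y \<ominus>\<^bsub>A\<^esub> \<chi> j y \<odot>\<^bsub>A\<^esub> \<one>\<^bsub>A\<^esub>"
  have w: "?w \<in> a_kernel A R (\<chi> j)" by (rule minus_character_in_kernel[OF \<chi>[OF j(1)] y(1)])
  then have wA: "?w \<in> carrier A" by (simp add: character_kernel_iff)
  have "\<chi> i ?w = \<chi> i y \<ominus> \<chi> j y"
    by (rule character_minus_scalar[OF \<chi>[OF i] y(1) \<chi>j(3)[OF y(1)]])
  then have "\<chi> i ?w \<noteq> \<zero>" using y \<chi>i(3) \<chi>j(3) by simp
  then have pow: "\<chi> i (?w [^]\<^bsub>A\<^esub> n) \<noteq> \<zero>" for n :: nat
    by (induction n) (use wA \<chi>i(3-5) in \<open>simp_all add: dom.integral_iff\<close>)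
  show ?case
  proof (intro bexI conjI ballI)
    let ?z = "z \<otimes>\<^bsub>A\<^esub> ?w [^]\<^bsub>A\<^esub> N j"
    show "?z \<in> carrier A" using z(1) wA by simp
    show "\<chi> i ?z \<noteq> \<zero>" using z(1,2) wA pow \<chi>i(3,4) by (simp add: dom.integral_iff)
    fix k assume "k \<in> insert j J"
    then consider "k = j" | "k \<in> J" by blast
    then show "?z \<in> submodule_power R A (a_kernel A R (\<chi> k)) (N k)"
    proof cases
      case 1
      show ?thesis
        unfolding 1
        by (intro submodule_power_l_closed ker nat_pow_mem_submodule_power w z j)
    next
      case 2
      show ?thesis
        using insert.prems 2 wA by (intro submodule_power_r_closed ker z(3)) auto
    qed
  qed
qed

text \<open>A separating element \<open>z\<close> for the index \<open>i\<close> turns every other summand off, so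
  \<open>h\<^sub>i(x z) = 0\<close> for all \<open>x\<close>. As \<open>z\<close> is the nonzero scalar \<open>\<chi>\<^sub>i(z)\<close> modulo the kernel of
  \<open>\<chi>\<^sub>i\<close>, vanishing of \<open>h\<^sub>i\<close> on one power of this kernel descends to the previous power, and
  eventually to the whole algebra.\<close>

lemma generalized_eigenfunctionals_independent:
  assumes i: "i \<in> I" and x: "x \<in> carrier A"
  shows "h i x = \<zero>"
proof -
  let ?P = "submodule_power R A (a_kernel A R (\<chi> i))"
  note \<chi>i = algebra_homsD[OF \<chi>[OF i]] and hi = linear_mapsD[OF h[OF i], simplified]
  note ker = character_kernel_ideal[OF \<chi>]
  obtain z where z: "z \<in> carrier A" "\<chi> i z \<noteq> \<zero>"
    "\<And>j. j \<in> I - {i} \<Longrightarrow> z \<in> submodule_power R A (a_kernel A R (\<chi> j)) (N j)"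
    using separating_element[OF i subset_refl] by blast
  have hz: "h i (x \<otimes>\<^bsub>A\<^esub> z) = \<zero>" if x: "x \<in> carrier A" for x
  proof -
    have "(\<Oplus>j\<in>I. h j (x \<otimes>\<^bsub>A\<^esub> z)) = (\<Oplus>j\<in>I. if i = j then h j (x \<otimes>\<^bsub>A\<^esub> z) else \<zero>)"
    proof (rule R.finsum_cong')
      show "h j (x \<otimes>\<^bsub>A\<^esub> z) = (if i = j then h j (x \<otimes>\<^bsub>A\<^esub> z) else \<zero>)" if "j \<in> I" for j
        using vanish[OF that] submodule_power_l_closed[OF ker[OF that] x z(3)] that by auto
    qed (use linear_mapsD(1)[OF h, simplified] x z(1) in auto)
    also have "\<dots> = h i (x \<otimes>\<^bsub>A\<^esub> z)"
      using linear_mapsD(1)[OF h, simplified] x z(1) by (intro R.finsum_singleton i fin) auto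
    finally show ?thesis using sum_zero x z(1) by simp
  qed
  let ?w = "z \<ominus>\<^bsub>A\<^esub> \<chi> i z \<odot>\<^bsub>A\<^esub> \<one>\<^bsub>A\<^esub>"
  have w: "?w \<in> a_kernel A R (\<chi> i)" by (rule minus_character_in_kernel[OF \<chi>[OF i] z(1)])
  then have wA: "?w \<in> carrier A" by (simp add: character_kernel_iff)
  have "\<forall>x\<in>?P 0. h i x = \<zero>"
  proof (rule inc_induct[of 0 "N i"])
    show "\<forall>x\<in>?P (N i). h i x = \<zero>" using vanish[OF i] by blast
    fix n assume IH: "\<forall>x\<in>?P (Suc n). h i x = \<zero>"
    show "\<forall>x\<in>?P n. h i x = \<zero>"
    proof
      fix x assume xn: "x \<in> ?P n"
      then have x: "x \<in> carrier A" by (rule submodule_power_closed[OF ker[OF i]])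
      have "z = \<chi> i z \<odot>\<^bsub>A\<^esub> \<one>\<^bsub>A\<^esub> \<oplus>\<^bsub>A\<^esub> ?w"
        using z(1) \<chi>i(3) by (simp add: a_minus_def M.a_lcomm M.r_neg)
      then have "h i (x \<otimes>\<^bsub>A\<^esub> z) = h i (x \<otimes>\<^bsub>A\<^esub> (\<chi> i z \<odot>\<^bsub>A\<^esub> \<one>\<^bsub>A\<^esub> \<oplus>\<^bsub>A\<^esub> ?w))" by simp
      also have "\<dots> = \<chi> i z \<otimes> h i x \<oplus> h i (x \<otimes>\<^bsub>A\<^esub> ?w)"
        using x z(1) wA \<chi>i(3) hi by (simp add: A.r_distr smult_mult_right)
      also have "h i (x \<otimes>\<^bsub>A\<^esub> ?w) = \<zero>"
        using IH submodule_power_mult_ideal[OF ker[OF i] xn w] by blast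
      finally have "\<chi> i z \<otimes> h i x = \<zero>"
        using hz[OF x] x z(1) \<chi>i(3) hi(1) by simp
      then show "h i x = \<zero>" using z x \<chi>i(3) hi(1) by (simp add: dom.integral_iff)
    qed
  qed simp
  with x show ?thesis by simp
qed

end

end

section \<open>The filtration of a bialgebra and its dual\<close>

context bialgebra
begin

abbreviation "J \<equiv> augmentation_ideal R B \<epsilon>"
abbreviation Jpow where "Jpow n \<equiv> submodule_power R B J n"
abbreviation BBmult (infixl \<open>\<bullet>\<close> 70) where "X \<bullet> Y \<equiv> X \<otimes>\<^bsub>tensor_algebra R B B\<^esub> Y"

lemma comult_mult:
  "\<lbrakk>x \<in> carrier B; y \<in> carrier B\<rbrakk> \<Longrightarrow> \<Delta> (x \<otimes>\<^bsub>B\<^esub> y) = \<Delta> x \<bullet> \<Delta> y"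
  using comult_hom by (simp add: algebra_homs_def ring_hom_def)

lemma BBmult_def: "X \<bullet> Y = tensor_lift R CC.T (\<lambda>a b. tensor_lift R CC.T
    (\<lambda>c d. CC.pt (a \<otimes>\<^bsub>B\<^esub> c) (b \<otimes>\<^bsub>B\<^esub> d)) Y) X"
  by (simp add: tensor_algebra_def)

lemma BBmult_inner_bilinear:
  "\<lbrakk>a \<in> carrier B; b \<in> carrier B\<rbrakk> \<Longrightarrow>
    (\<lambda>c d. CC.pt (a \<otimes>\<^bsub>B\<^esub> c) (b \<otimes>\<^bsub>B\<^esub> d)) \<in> bilinear_maps R B B CC.T"
  by (intro bilinear_maps_compose[OF CC.pure_tensor_bilinear] left_mult_linear)

lemma BBmult_outer_bilinear:
  assumes Y: "Y \<in> carrier CC.T"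
  shows "(\<lambda>a b. tensor_lift R CC.T (\<lambda>c d. CC.pt (a \<otimes>\<^bsub>B\<^esub> c) (b \<otimes>\<^bsub>B\<^esub> d)) Y)
    \<in> bilinear_maps R B B CC.T"
proof (rule bilinear_mapsI)
  note pt = bilinear_mapsD[OF CC.pure_tensor_bilinear]
  fix a assume a: "a \<in> carrier B"
  show "(\<lambda>b. tensor_lift R CC.T (\<lambda>c d. CC.pt (a \<otimes>\<^bsub>B\<^esub> c) (b \<otimes>\<^bsub>B\<^esub> d)) Y) \<in> linear_maps R B CC.T"
    using a Y
    by (intro bilinear_mapsD(1)[OF CC.tensor_lift_param_bilinear] CC.tensor_is_module
        module_axioms BBmult_inner_bilinear linear_maps_compose[OF right_mult_linear pt(1)]) auto
next
  note pt = bilinear_mapsD[OF CC.pure_tensor_bilinear]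
  fix b assume b: "b \<in> carrier B"
  show "(\<lambda>a. tensor_lift R CC.T (\<lambda>c d. CC.pt (a \<otimes>\<^bsub>B\<^esub> c) (b \<otimes>\<^bsub>B\<^esub> d)) Y) \<in> linear_maps R B CC.T"
    using b Y
    by (intro bilinear_mapsD(1)[OF CC.tensor_lift_param_bilinear] CC.tensor_is_module
        module_axioms BBmult_inner_bilinear linear_maps_compose[OF right_mult_linear pt(2)]) auto
qed

lemma BBmult_linear_left: "Y \<in> carrier CC.T \<Longrightarrow> (\<lambda>X. X \<bullet> Y) \<in> linear_maps R CC.T CC.T"
  unfolding BBmult_def
  by (rule CC.tensor_lift_linear[OF CC.tensor_is_module BBmult_outer_bilinear])

lemma BBmult_linear_right: "X \<in> carrier CC.T \<Longrightarrow> (\<lambda>Y. X \<bullet> Y) \<in> linear_maps R CC.T CC.T"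
  unfolding BBmult_def
  by (rule bilinear_mapsD(1)[OF CC.tensor_lift_param_bilinear[OF CC.tensor_is_module
          BBmult_outer_bilinear CC.tensor_lift_linear[OF CC.tensor_is_module BBmult_inner_bilinear]
          CC.tensor_is_module]])

lemma BBmult_pure:
  "\<lbrakk>a \<in> carrier B; b \<in> carrier B; c \<in> carrier B; d \<in> carrier B\<rbrakk> \<Longrightarrow>
    CC.pt a b \<bullet> CC.pt c d = CC.pt (a \<otimes>\<^bsub>B\<^esub> c) (b \<otimes>\<^bsub>B\<^esub> d)"
  unfolding BBmult_def
  by (simp add: CC.tensor_lift_pure[OF CC.tensor_is_module BBmult_outer_bilinear]
      CC.tensor_lift_pure[OF CC.tensor_is_module BBmult_inner_bilinear] CC.pure_tensor_closed)

lemma augmentation_ideal_ideal: "ideal J B"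
  unfolding augmentation_ideal_def by (rule character_kernel_ideal[OF counit_hom])

lemma augmentation_ideal_iff: "x \<in> J \<longleftrightarrow> x \<in> carrier B \<and> \<epsilon> x = \<zero>"
  unfolding augmentation_ideal_def by (rule character_kernel_iff)

lemmas Jpow_submodule = submodule_power_submodule[OF augmentation_ideal_ideal]
lemmas Jpow_closed = submodule_power_closed[OF augmentation_ideal_ideal]
lemmas Jpow_mult = submodule_power_mult[OF augmentation_ideal_ideal]
lemmas Jpow_antimono = submodule_power_antimono[OF augmentation_ideal_ideal]

text \<open>The filtration \<open>\<Sum>\<^bsub>i+j=n\<^esub> J\<^sup>i \<otimes> J\<^sup>j\<close> that the powers of \<open>J\<close> induce on \<open>B \<otimes> B\<close>.\<close>

definition tensor_filtration
  where "tensor_filtration (n::nat) = module_span R CC.T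
    {CC.pt a b | a b. \<exists>i j. i + j = n \<and> a \<in> Jpow i \<and> b \<in> Jpow j}"

lemma tensor_filtration_submodule: "submodule (tensor_filtration n) R CC.T"
  unfolding tensor_filtration_def
  by (rule submodule_module_span[OF CC.tensor_is_module])
    (auto intro: CC.pure_tensor_closed Jpow_closed)

lemma tensor_filtration_closed: "X \<in> tensor_filtration n \<Longrightarrow> X \<in> carrier CC.T"
  using CC.T.submoduleE(1)[OF tensor_filtration_submodule] by blast

lemma pure_in_tensor_filtration:
  "\<lbrakk>a \<in> Jpow i; b \<in> Jpow j\<rbrakk> \<Longrightarrow> CC.pt a b \<in> tensor_filtration (i + j)"
  unfolding tensor_filtration_def by (rule subsetD[OF module_span_superset]) auto

lemma tensor_filtration_subset:
  assumes "submodule H R CC.T"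
    and "\<And>a b i j. \<lbrakk>i + j = n; a \<in> Jpow i; b \<in> Jpow j\<rbrakk> \<Longrightarrow> CC.pt a b \<in> H"
  shows "tensor_filtration n \<subseteq> H"
  unfolding tensor_filtration_def using assms by (intro module_span_least) auto

lemma tensor_filtration_mult:
  assumes X: "X \<in> tensor_filtration m" and Y: "Y \<in> tensor_filtration n"
  shows "X \<bullet> Y \<in> tensor_filtration (m + n)"
proof -
  note sub = submodule_vimage[OF CC.tensor_is_module CC.tensor_is_module _ tensor_filtration_submodule]
  have "tensor_filtration m \<subseteq> {X \<in> carrier CC.T. X \<bullet> Y \<in> tensor_filtration (m + n)}"
  proof (rule tensor_filtration_subset[OF sub[OF BBmult_linear_left[OF tensor_filtration_closed[OF Y]]]])
    fix a b i j assume ij: "i + j = m" and a: "a \<in> Jpow i" and b: "b \<in> Jpow j"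
    have ab: "CC.pt a b \<in> carrier CC.T"
      by (rule CC.pure_tensor_closed[OF Jpow_closed[OF a] Jpow_closed[OF b]])
    have "tensor_filtration n \<subseteq> {Y \<in> carrier CC.T. CC.pt a b \<bullet> Y \<in> tensor_filtration (m + n)}"
    proof (rule tensor_filtration_subset[OF sub[OF BBmult_linear_right[OF ab]]])
      fix c d k l assume kl: "k + l = n" and c: "c \<in> Jpow k" and d: "d \<in> Jpow l"
      have "CC.pt (a \<otimes>\<^bsub>B\<^esub> c) (b \<otimes>\<^bsub>B\<^esub> d) \<in> tensor_filtration ((i + k) + (j + l))"
        by (rule pure_in_tensor_filtration[OF Jpow_mult[OF a c] Jpow_mult[OF b d]])
      moreover have "(i + k) + (j + l) = m + n" using ij kl by simp
      ultimately show "CC.pt c d \<in> {Y \<in> carrier CC.T. CC.pt a b \<bullet> Y \<in> tensor_filtration (m + n)}"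
        using BBmult_pure[OF Jpow_closed[OF a] Jpow_closed[OF b] Jpow_closed[OF c] Jpow_closed[OF d]]
          CC.pure_tensor_closed[OF Jpow_closed[OF c] Jpow_closed[OF d]] by simp
    qed
    with Y ab show "CC.pt a b \<in> {X \<in> carrier CC.T. X \<bullet> Y \<in> tensor_filtration (m + n)}"
      by blast
  qed
  with X show ?thesis by blast
qed

text \<open>On pure tensors this is the identity
  \<open>x \<otimes> y = (x - \<epsilon>(x) 1) \<otimes> y + \<epsilon>(x) 1 \<otimes> (y - \<epsilon>(y) 1) + \<epsilon>(x) \<epsilon>(y) 1 \<otimes> 1\<close>.\<close>

lemma tensor_decompose:
  assumes "X \<in> carrier CC.T"
  shows "\<exists>Y\<in>tensor_filtration 1.
    X = Y \<oplus>\<^bsub>CC.T\<^esub> form_tensor \<epsilon> \<epsilon> X \<odot>\<^bsub>CC.T\<^esub> CC.pt \<one>\<^bsub>B\<^esub> \<one>\<^bsub>B\<^esub>"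
  using assms
proof (induction X rule: CC.tensor_induct)
  case (pure x y)
  let ?p = "x \<ominus>\<^bsub>B\<^esub> \<epsilon> x \<odot>\<^bsub>B\<^esub> \<one>\<^bsub>B\<^esub>" and ?q = "y \<ominus>\<^bsub>B\<^esub> \<epsilon> y \<odot>\<^bsub>B\<^esub> \<one>\<^bsub>B\<^esub>"
  have p: "?p \<in> Jpow 1" and q: "?q \<in> Jpow 1"
    using minus_character_in_kernel[OF counit_hom] pure by (simp_all add: augmentation_ideal_def)
  note pq = Jpow_closed[OF p] Jpow_closed[OF q]
  have \<epsilon>: "\<epsilon> x \<in> carrier R" "\<epsilon> y \<in> carrier R" using algebra_homsD(3)[OF counit_hom] pure by auto
  note lin = linear_mapsD(2,3)[OF bilinear_mapsD(1)[OF CC.pure_tensor_bilinear]]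
    linear_mapsD(2,3)[OF bilinear_mapsD(2)[OF CC.pure_tensor_bilinear]]
  let ?Y = "CC.pt ?p y \<oplus>\<^bsub>CC.T\<^esub> CC.pt (\<epsilon> x \<odot>\<^bsub>B\<^esub> \<one>\<^bsub>B\<^esub>) ?q"
  have Y: "?Y \<in> tensor_filtration 1"
    using pure_in_tensor_filtration[OF p, of y 0] pure_in_tensor_filtration[of _ 0, OF _ q] pure \<epsilon>
    by (intro CC.T.submoduleE(5)[OF tensor_filtration_submodule]) auto
  have split: "z = (z \<ominus>\<^bsub>B\<^esub> \<epsilon> z \<odot>\<^bsub>B\<^esub> \<one>\<^bsub>B\<^esub>) \<oplus>\<^bsub>B\<^esub> \<epsilon> z \<odot>\<^bsub>B\<^esub> \<one>\<^bsub>B\<^esub>" if "z \<in> carrier B" for z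
    using that algebra_homsD(3)[OF counit_hom that] by (simp add: a_minus_def M.a_assoc M.l_neg)
  have "CC.pt x y = CC.pt (?p \<oplus>\<^bsub>B\<^esub> \<epsilon> x \<odot>\<^bsub>B\<^esub> \<one>\<^bsub>B\<^esub>) y"
    using split[OF pure(1)] by simp
  also have "\<dots> = CC.pt ?p y \<oplus>\<^bsub>CC.T\<^esub> CC.pt (\<epsilon> x \<odot>\<^bsub>B\<^esub> \<one>\<^bsub>B\<^esub>) y"
    using pure pq \<epsilon> by (intro lin) auto
  also have "CC.pt (\<epsilon> x \<odot>\<^bsub>B\<^esub> \<one>\<^bsub>B\<^esub>) y =
      CC.pt (\<epsilon> x \<odot>\<^bsub>B\<^esub> \<one>\<^bsub>B\<^esub>) (?q \<oplus>\<^bsub>B\<^esub> \<epsilon> y \<odot>\<^bsub>B\<^esub> \<one>\<^bsub>B\<^esub>)"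
    using split[OF pure(2)] by simp
  also have "\<dots> = CC.pt (\<epsilon> x \<odot>\<^bsub>B\<^esub> \<one>\<^bsub>B\<^esub>) ?q \<oplus>\<^bsub>CC.T\<^esub>
      CC.pt (\<epsilon> x \<odot>\<^bsub>B\<^esub> \<one>\<^bsub>B\<^esub>) (\<epsilon> y \<odot>\<^bsub>B\<^esub> \<one>\<^bsub>B\<^esub>)"
    using pure pq \<epsilon> by (intro lin) auto
  also have "CC.pt (\<epsilon> x \<odot>\<^bsub>B\<^esub> \<one>\<^bsub>B\<^esub>) (\<epsilon> y \<odot>\<^bsub>B\<^esub> \<one>\<^bsub>B\<^esub>) =
      (\<epsilon> x \<otimes> \<epsilon> y) \<odot>\<^bsub>CC.T\<^esub> CC.pt \<one>\<^bsub>B\<^esub> \<one>\<^bsub>B\<^esub>"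
    using \<epsilon> by (simp add: lin CC.pure_tensor_closed R.m_comm flip: CC.T.smult_assoc1)
  also have "CC.pt ?p y \<oplus>\<^bsub>CC.T\<^esub> (CC.pt (\<epsilon> x \<odot>\<^bsub>B\<^esub> \<one>\<^bsub>B\<^esub>) ?q \<oplus>\<^bsub>CC.T\<^esub>
      (\<epsilon> x \<otimes> \<epsilon> y) \<odot>\<^bsub>CC.T\<^esub> CC.pt \<one>\<^bsub>B\<^esub> \<one>\<^bsub>B\<^esub>) =
      ?Y \<oplus>\<^bsub>CC.T\<^esub> form_tensor \<epsilon> \<epsilon> (CC.pt x y) \<odot>\<^bsub>CC.T\<^esub> CC.pt \<one>\<^bsub>B\<^esub> \<one>\<^bsub>B\<^esub>"
    using pure pq \<epsilon>
    by (simp add: CC.T.a_assoc CC.pure_tensor_closed form_tensor_pure counit_linear)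
  finally have "CC.pt x y =
      ?Y \<oplus>\<^bsub>CC.T\<^esub> form_tensor \<epsilon> \<epsilon> (CC.pt x y) \<odot>\<^bsub>CC.T\<^esub> CC.pt \<one>\<^bsub>B\<^esub> \<one>\<^bsub>B\<^esub>" .
  with Y show ?case by blast
next
  case (add X X')
  then obtain Y Y' where Y: "Y \<in> tensor_filtration 1" "Y' \<in> tensor_filtration 1"
    "X = Y \<oplus>\<^bsub>CC.T\<^esub> form_tensor \<epsilon> \<epsilon> X \<odot>\<^bsub>CC.T\<^esub> CC.pt \<one>\<^bsub>B\<^esub> \<one>\<^bsub>B\<^esub>"
    "X' = Y' \<oplus>\<^bsub>CC.T\<^esub> form_tensor \<epsilon> \<epsilon> X' \<odot>\<^bsub>CC.T\<^esub> CC.pt \<one>\<^bsub>B\<^esub> \<one>\<^bsub>B\<^esub>" by blast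
  let ?u = "CC.pt \<one>\<^bsub>B\<^esub> \<one>\<^bsub>B\<^esub>"
  define c c' where c: "c = form_tensor \<epsilon> \<epsilon> X" "c' = form_tensor \<epsilon> \<epsilon> X'"
  note \<epsilon> = linear_mapsD[OF form_tensor_linear[OF counit_linear counit_linear], simplified]
  have cc: "c \<in> carrier R" "c' \<in> carrier R" using \<epsilon>(1) add c by auto
  have u: "?u \<in> carrier CC.T" by (simp add: CC.pure_tensor_closed)
  have YT: "Y \<in> carrier CC.T" "Y' \<in> carrier CC.T" using Y tensor_filtration_closed by auto
  have "X \<oplus>\<^bsub>CC.T\<^esub> X' = (Y \<oplus>\<^bsub>CC.T\<^esub> c \<odot>\<^bsub>CC.T\<^esub> ?u) \<oplus>\<^bsub>CC.T\<^esub> (Y' \<oplus>\<^bsub>CC.T\<^esub> c' \<odot>\<^bsub>CC.T\<^esub> ?u)"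
    using Y(3,4) c by simp
  also have "\<dots> = (Y \<oplus>\<^bsub>CC.T\<^esub> Y') \<oplus>\<^bsub>CC.T\<^esub> (c \<oplus> c') \<odot>\<^bsub>CC.T\<^esub> ?u"
    using cc u YT by (simp add: CC.T.smult_l_distr CC.T.a_ac)
  also have "c \<oplus> c' = form_tensor \<epsilon> \<epsilon> (X \<oplus>\<^bsub>CC.T\<^esub> X')"
    using \<epsilon>(2) add c by simp
  finally show ?case
    using CC.T.submoduleE(5)[OF tensor_filtration_submodule Y(1,2)] by blast
qed

lemma form_tensor_counit: "x \<in> carrier B \<Longrightarrow> form_tensor \<epsilon> \<epsilon> (\<Delta> x) = \<epsilon> x"
  using convolution_unit(1)[OF counit_linear counit_linear]
  by (simp add: convolution_eq[OF counit_linear counit_linear])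

text \<open>By the counit axiom, \<open>(\<epsilon> \<otimes> \<epsilon>)(\<Delta> x) = \<epsilon>(x)\<close>, so the multiple of \<open>1 \<otimes> 1\<close> in the
  decomposition of \<open>\<Delta> x\<close> disappears for \<open>x\<close> in \<open>J\<close>.\<close>

lemma comult_augmentation_ideal:
  assumes "x \<in> J"
  shows "\<Delta> x \<in> tensor_filtration 1"
proof -
  have x: "x \<in> carrier B" "\<epsilon> x = \<zero>" using assms by (auto simp: augmentation_ideal_iff)
  from tensor_decompose[OF comult_closed[OF x(1)]] show ?thesis
    using x tensor_filtration_closed[of _ 1] by (auto simp: form_tensor_counit CC.pure_tensor_closed)
qed

text \<open>\<open>\<Delta>\<close> is multiplicative and so is the filtration of \<open>B \<otimes> B\<close>.\<close>

lemma comult_Jpow: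
  assumes "x \<in> Jpow n"
  shows "\<Delta> x \<in> tensor_filtration n"
proof (cases n)
  case 0
  have "X \<in> tensor_filtration 0" if "X \<in> carrier CC.T" for X
    using that
  proof (induction X rule: CC.tensor_induct)
    case (pure x y)
    then show ?case using pure_in_tensor_filtration[of x 0 y 0] by simp
  next
    case (add X Y)
    then show ?case using CC.T.submoduleE(5)[OF tensor_filtration_submodule] by blast
  qed
  with 0 assms show ?thesis by (simp add: comult_closed)
next
  case (Suc m)
  have "Jpow (Suc m) \<subseteq> {x \<in> carrier B. \<Delta> x \<in> tensor_filtration (Suc m)}"
  proof (induction m)
    case 0
    then show ?case
      using comult_augmentation_ideal by (auto simp: augmentation_ideal_iff)
  next
    case (Suc m)
    show ?case
    proof (rule submodule_power_Suc_Suc_least[OF augmentation_ideal_ideal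
          submodule_vimage[OF module_axioms CC.tensor_is_module comult_linear tensor_filtration_submodule]])
      fix x u assume x: "x \<in> Jpow (Suc m)" and u: "u \<in> J"
      have xu: "x \<in> carrier B" "u \<in> carrier B"
        using Jpow_closed[OF x] u by (auto simp: augmentation_ideal_iff)
      have "\<Delta> x \<in> tensor_filtration (Suc m)" using Suc x by blast
      from tensor_filtration_mult[OF this comult_augmentation_ideal[OF u]]
      show "x \<otimes>\<^bsub>B\<^esub> u \<in> {x \<in> carrier B. \<Delta> x \<in> tensor_filtration (Suc (Suc m))}"
        using xu by (simp add: comult_mult)
    qed
  qed
  with assms Suc show ?thesis by blast
qed

text \<open>A pure tensor in \<open>J\<^sup>i \<otimes> J\<^sup>j\<close> with \<open>i + j = n\<close> is killed by \<open>f \<otimes> g\<close>, because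
  \<open>p + q \<le> n + 1\<close> excludes \<open>i < p\<close> together with \<open>j < q\<close>.\<close>

lemma convolution_vanishes_on_Jpow:
  assumes f: "f \<in> linear_maps R B S" "\<And>x. x \<in> Jpow p \<Longrightarrow> f x = \<zero>"
    and g: "g \<in> linear_maps R B S" "\<And>x. x \<in> Jpow q \<Longrightarrow> g x = \<zero>"
    and pq: "p + q \<le> Suc n" and x: "x \<in> Jpow n"
  shows "convolution R B \<Delta> f g x = \<zero>"
proof -
  have "tensor_filtration n \<subseteq> {X \<in> carrier CC.T. form_tensor f g X = \<zero>}"
  proof (rule tensor_filtration_subset)
    show "submodule {X \<in> carrier CC.T. form_tensor f g X = \<zero>} R CC.T"
      using submodule_kernel[OF CC.tensor_is_module S_module form_tensor_linear[OF f(1) g(1)]] by simp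
    fix a b i j assume ij: "i + j = n" and a: "a \<in> Jpow i" and b: "b \<in> Jpow j"
    note ab = Jpow_closed[OF a] Jpow_closed[OF b]
    have "p \<le> i \<or> q \<le> j" using ij pq by linarith
    then have "f a = \<zero> \<or> g b = \<zero>"
      using a b f(2) g(2) Jpow_antimono by blast
    then show "CC.pt a b \<in> {X \<in> carrier CC.T. form_tensor f g X = \<zero>}"
      using ab linear_mapsD(1)[OF f(1)] linear_mapsD(1)[OF g(1)]
      by (auto simp: CC.pure_tensor_closed form_tensor_pure f(1) g(1))
  qed
  with comult_Jpow[OF x] show ?thesis
    using Jpow_closed[OF x] by (auto simp: convolution_eq f(1) g(1))
qed

end

lemma (in coalgebra) annihilator_submodule:
  assumes X: "X \<subseteq> carrier C"
  shows "submodule {f \<in> carrier dual. \<forall>x\<in>X. f x = \<zero>} R dual"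
proof (rule D.submoduleI)
  note ev = dual_evaluation_linear[OF subsetD[OF X]]
  note ev' = linear_mapsD[OF ev, simplified]
  show "\<zero>\<^bsub>dual\<^esub> \<in> {f \<in> carrier dual. \<forall>x\<in>X. f x = \<zero>}"
    using linear_maps_zero[OF dual_is_module S_module ev] by auto
  show "\<ominus>\<^bsub>dual\<^esub> f \<in> {f \<in> carrier dual. \<forall>x\<in>X. f x = \<zero>}"
    if "f \<in> {f \<in> carrier dual. \<forall>x\<in>X. f x = \<zero>}" for f
    using that linear_maps_a_inv[OF dual_is_module S_module ev] by auto
  show "f \<oplus>\<^bsub>dual\<^esub> g \<in> {f \<in> carrier dual. \<forall>x\<in>X. f x = \<zero>}"
    if "f \<in> {f \<in> carrier dual. \<forall>x\<in>X. f x = \<zero>}" "g \<in> {f \<in> carrier dual. \<forall>x\<in>X. f x = \<zero>}" for f g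
    using that by (auto simp: ev'(2))
  show "a \<odot>\<^bsub>dual\<^esub> f \<in> {f \<in> carrier dual. \<forall>x\<in>X. f x = \<zero>}"
    if "a \<in> carrier R" "f \<in> {f \<in> carrier dual. \<forall>x\<in>X. f x = \<zero>}" for a f
    using that by (auto simp: ev'(3))
qed blast

lemma (in coalgebra) dual_finsum_apply:
  assumes "finite I" and "h \<in> I \<rightarrow> carrier dual" and x: "x \<in> carrier C"
  shows "(\<Oplus>\<^bsub>dual\<^esub>i\<in>I. h i) x = (\<Oplus>i\<in>I. h i x)"
  using assms(1,2)
proof (induction I rule: finite_induct)
  case empty
  then show ?case using x by (simp add: dual_simps)
next
  case (insert i I)
  note ev = linear_mapsD[OF dual_evaluation_linear[OF x], simplified]
  show ?case
    using insert by (simp add: D.finsum_insert R.finsum_insert ev Pi_def)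
qed

context bialgebra
begin

abbreviation "filt \<equiv> dual_filtration R B \<Delta> \<epsilon>"

lemma filt_iff:
  "-1 \<le> N \<Longrightarrow> f \<in> filt N \<longleftrightarrow> f \<in> carrier dual \<and> (\<forall>x\<in>Jpow (nat (N + 1)). f x = \<zero>)"
  by (simp add: dual_filtration_def)

lemma filt_submodule: "submodule (filt N) R dual"
proof (cases "-1 \<le> N")
  case True
  have "filt N = {f \<in> carrier dual. \<forall>x\<in>Jpow (nat (N + 1)). f x = \<zero>}"
    using filt_iff[OF True] by blast
  then show ?thesis
    using annihilator_submodule[of "Jpow (nat (N + 1))"] Jpow_closed by auto
next
  case False
  then show ?thesis by (simp add: dual_filtration_def D.zero_submodule)
qed

lemma filt_mono:
  assumes "-1 \<le> M" "M \<le> N"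
  shows "filt M \<subseteq> filt N"
proof -
  have "Jpow (nat (N + 1)) \<subseteq> Jpow (nat (M + 1))" using assms by (intro Jpow_antimono) simp
  then show ?thesis using assms by (simp add: filt_iff subset_iff)
qed

lemma filt_minus_one: "filt (-1) = {\<zero>\<^bsub>dual\<^esub>}"
proof
  show "filt (-1) \<subseteq> {\<zero>\<^bsub>dual\<^esub>}"
  proof
    fix f assume "f \<in> filt (-1)"
    then have "f \<in> carrier dual" "\<And>x. x \<in> carrier B \<Longrightarrow> f x = \<zero>" by (auto simp: filt_iff)
    then have "f = \<zero>\<^bsub>dual\<^esub>"
      by (intro dual_eqI D.zero_closed) (simp_all add: dual_simps(4))
    then show "f \<in> {\<zero>\<^bsub>dual\<^esub>}" by simp
  qed
qed (use D.zero_closed in \<open>auto simp: filt_iff dual_simps(4)\<close>)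

text \<open>Index \<open>p\<close> of the filtration belongs to the power \<open>p + 1\<close> of \<open>J\<close>. If \<open>p = q = -1\<close>, there is no power
  to test the product on, but then both factors are zero.\<close>

lemma filt_mult:
  assumes p: "-1 \<le> p" and q: "-1 \<le> q" and f: "f \<in> filt p" and g: "g \<in> filt q"
  shows "f \<otimes>\<^bsub>dual\<^esub> g \<in> filt (p + q)"
proof -
  have fg: "f \<in> carrier dual" "g \<in> carrier dual" using f g p q by (auto simp: filt_iff)
  then have lin: "f \<in> linear_maps R B S" "g \<in> linear_maps R B S" by (simp_all add: dual_simps)
  show ?thesis
  proof (cases "-1 \<le> p + q")
    case True
    have "(f \<otimes>\<^bsub>dual\<^esub> g) x = \<zero>" if "x \<in> Jpow (nat (p + q + 1))" for x
      unfolding dual_simps(2)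
      using f g p q True that
      by (intro convolution_vanishes_on_Jpow[OF lin(1) _ lin(2), of "nat (p + 1)" "nat (q + 1)"])
        (auto simp: filt_iff)
    then show ?thesis using fg True by (simp add: filt_iff dual_mult_closed)
  next
    case False
    then have pq: "p = -1" "q = -1" using p q by auto
    then have "f x = \<zero>" if "x \<in> carrier B" for x using f that by (simp add: filt_iff)
    then have "f \<otimes>\<^bsub>dual\<^esub> g = \<zero>\<^bsub>dual\<^esub>"
      using fg by (intro dual_eqI dual_mult_closed D.zero_closed)
        (simp_all add: dual_simps(2,4) convolution_zero_left lin)
    then show ?thesis using False by (simp add: dual_filtration_def)
  qed
qed

lemma filt_prod_subset:
  assumes "-1 \<le> p" "-1 \<le> q"
  shows "submodule_prod R dual (filt p) (filt q) \<subseteq> filt (p + q)"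
  unfolding submodule_prod_def
  using filt_mult[OF assms] by (intro module_span_least[OF filt_submodule]) auto

abbreviation "filt_union \<equiv> dual_filtration_union R B \<Delta> \<epsilon>"

lemma filt_union_iff: "f \<in> filt_union \<longleftrightarrow> (\<exists>N\<ge>-1. f \<in> filt N)"
  by (auto simp: dual_filtration_union_def)

lemma filt_union_submodule: "submodule filt_union R dual"
proof (rule D.submoduleI)
  note sub = D.submoduleE[OF filt_submodule]
  show "filt_union \<subseteq> carrier dual" using subsetD[OF sub(1)] by (auto simp: filt_union_iff)
  show "\<zero>\<^bsub>dual\<^esub> \<in> filt_union" using filt_minus_one by (auto simp: filt_union_iff)
  show "\<ominus>\<^bsub>dual\<^esub> f \<in> filt_union" if "f \<in> filt_union" for f
    using that sub(3) by (auto simp: filt_union_iff)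
  show "a \<odot>\<^bsub>dual\<^esub> f \<in> filt_union" if "a \<in> carrier R" "f \<in> filt_union" for a f
    using that sub(4) by (auto simp: filt_union_iff)
  fix f g assume "f \<in> filt_union" "g \<in> filt_union"
  then obtain M N where MN: "-1 \<le> M" "f \<in> filt M" "-1 \<le> N" "g \<in> filt N"
    by (auto simp: filt_union_iff)
  then have "f \<in> filt (max M N)" "g \<in> filt (max M N)"
    using filt_mono[of M "max M N"] filt_mono[of N "max M N"] by auto
  then have "f \<oplus>\<^bsub>dual\<^esub> g \<in> filt (max M N)" by (rule sub(5))
  moreover have "-1 \<le> max M N" using MN by simp
  ultimately show "f \<oplus>\<^bsub>dual\<^esub> g \<in> filt_union" by (auto simp: filt_union_iff)
qed

lemma filt_union_subalgebra: "is_subalgebra R dual filt_union"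
proof -
  note sub = filt_union_submodule
  have "submonoid filt_union dual"
  proof (rule submonoid.intro)
    show "filt_union \<subseteq> carrier dual" using D.submoduleE(1)[OF sub] .
    have "\<one>\<^bsub>dual\<^esub> \<in> filt 0"
      using dual_one_closed by (auto simp: filt_iff augmentation_ideal_iff dual_simps(3))
    then show "\<one>\<^bsub>dual\<^esub> \<in> filt_union" by (auto simp: filt_union_iff intro!: exI[of _ 0])
    fix f g assume "f \<in> filt_union" "g \<in> filt_union"
    then obtain p q where pq: "-1 \<le> p" "f \<in> filt p" "-1 \<le> q" "g \<in> filt q"
      by (auto simp: filt_union_iff)
    then have fg: "f \<otimes>\<^bsub>dual\<^esub> g \<in> filt (p + q)" by (intro filt_mult)
    show "f \<otimes>\<^bsub>dual\<^esub> g \<in> filt_union"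
    proof (cases "-1 \<le> p + q")
      case True
      with fg show ?thesis by (auto simp: filt_union_iff)
    next
      case False
      then have "filt (p + q) = filt (-1)"
        using filt_minus_one by (simp add: dual_filtration_def)
      with fg show ?thesis by (auto simp: filt_union_iff)
    qed
  qed
  then show ?thesis
    using sub submodule.axioms(1)[OF sub] by (simp add: is_subalgebra_def subring_def)
qed

section \<open>Translation by a character\<close>

context
  fixes g assumes g: "g \<in> algebra_homs R B S"
begin

definition shift_lift where "shift_lift = tensor_lift R B (\<lambda>a b. g b \<odot>\<^bsub>B\<^esub> a)"

text \<open>In Sweedler notation, \<open>shift x = \<Sum> g(x\<^sub>2) x\<^sub>1\<close>.\<close>

definition shift where "shift x = shift_lift (\<Delta> x)"

lemma g_linear: "g \<in> linear_maps R B S"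
  by (rule algebra_homsD(1)[OF g])

lemma shift_bilinear: "(\<lambda>a b. g b \<odot>\<^bsub>B\<^esub> a) \<in> bilinear_maps R B B B"
  by (rule bilinear_maps_compose[OF smult_bilinear' id_linear g_linear])

lemma shift_lift_linear: "shift_lift \<in> linear_maps R CC.T B"
  unfolding shift_lift_def by (rule CC.tensor_lift_linear[OF module_axioms shift_bilinear])

lemma shift_lift_pure:
  "\<lbrakk>a \<in> carrier B; b \<in> carrier B\<rbrakk> \<Longrightarrow> shift_lift (CC.pt a b) = g b \<odot>\<^bsub>B\<^esub> a"
  unfolding shift_lift_def by (rule CC.tensor_lift_pure[OF module_axioms shift_bilinear])

lemma shift_linear: "shift \<in> linear_maps R B B"
  using linear_maps_compose[OF comult_linear shift_lift_linear] by (simp add: shift_def[abs_def])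

text \<open>On pure tensors both sides are \<open>g(b) g(d) (a c)\<close>, by multiplicativity of \<open>g\<close>.\<close>

lemma shift_lift_mult:
  assumes X: "X \<in> carrier CC.T" and Y: "Y \<in> carrier CC.T"
  shows "shift_lift (X \<bullet> Y) = shift_lift X \<otimes>\<^bsub>B\<^esub> shift_lift Y"
proof (rule CC.tensor_maps_eqI[OF _ _ _ X])
  note closed = linear_mapsD(1)[OF shift_lift_linear]
  show "(\<lambda>X. shift_lift (X \<bullet> Y)) \<in> linear_maps R CC.T B"
    by (rule linear_maps_compose[OF BBmult_linear_left[OF Y] shift_lift_linear])
  show "(\<lambda>X. shift_lift X \<otimes>\<^bsub>B\<^esub> shift_lift Y) \<in> linear_maps R CC.T B"
    by (rule linear_maps_compose[OF shift_lift_linear right_mult_linear[OF closed[OF Y]]])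
  fix a b assume ab: "a \<in> carrier B" "b \<in> carrier B"
  note abT = CC.pure_tensor_closed[OF ab]
  show "shift_lift (CC.pt a b \<bullet> Y) = shift_lift (CC.pt a b) \<otimes>\<^bsub>B\<^esub> shift_lift Y"
  proof (rule CC.tensor_maps_eqI[OF _ _ _ Y])
    show "(\<lambda>Y. shift_lift (CC.pt a b \<bullet> Y)) \<in> linear_maps R CC.T B"
      by (rule linear_maps_compose[OF BBmult_linear_right[OF abT] shift_lift_linear])
    show "(\<lambda>Y. shift_lift (CC.pt a b) \<otimes>\<^bsub>B\<^esub> shift_lift Y) \<in> linear_maps R CC.T B"
      by (rule linear_maps_compose[OF shift_lift_linear left_mult_linear[OF closed[OF abT]]])
    fix c d assume cd: "c \<in> carrier B" "d \<in> carrier B"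
    show "shift_lift (CC.pt a b \<bullet> CC.pt c d) = shift_lift (CC.pt a b) \<otimes>\<^bsub>B\<^esub> shift_lift (CC.pt c d)"
      using ab cd algebra_homsD(3,4)[OF g]
      by (simp add: BBmult_pure shift_lift_pure smult_mult_left smult_mult_right R.m_comm
          flip: smult_assoc1)
  qed
qed

lemma shift_mult:
  "\<lbrakk>x \<in> carrier B; y \<in> carrier B\<rbrakk> \<Longrightarrow> shift (x \<otimes>\<^bsub>B\<^esub> y) = shift x \<otimes>\<^bsub>B\<^esub> shift y"
  by (simp add: shift_def comult_mult shift_lift_mult comult_closed)

lemma convolution_eq_shift:
  assumes f: "f \<in> linear_maps R B S" and x: "x \<in> carrier B"
  shows "convolution R B \<Delta> f g x = f (shift x)"
  unfolding shift_def convolution_eq[OF f g_linear x]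
proof (rule CC.tensor_maps_eqI[OF form_tensor_linear[OF f g_linear]
      linear_maps_compose[OF shift_lift_linear f] _ comult_closed[OF x]])
  fix a b assume "a \<in> carrier B" "b \<in> carrier B"
  then show "form_tensor f g (CC.pt a b) = f (shift_lift (CC.pt a b))"
    using linear_mapsD(1)[OF f] algebra_homsD(3)[OF g]
    by (simp add: form_tensor_pure[OF f g_linear] shift_lift_pure linear_mapsD(3)[OF f] R.m_comm)
qed

text \<open>The counit axiom gives \<open>\<epsilon>(shift x) = \<Sum> \<epsilon>(x\<^sub>1) g(x\<^sub>2) = g(x)\<close>.\<close>

lemma shift_kernel:
  assumes "x \<in> a_kernel B R g"
  shows "shift x \<in> J"
  using assms convolution_eq_shift[OF counit_linear, of x]
    convolution_unit(1)[OF g_linear counit_linear, of x] linear_mapsD(1)[OF shift_linear]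
  by (simp add: character_kernel_iff augmentation_ideal_iff)

lemma shift_kernel_power:
  assumes "x \<in> submodule_power R B (a_kernel B R g) n"
  shows "shift x \<in> Jpow n"
proof (cases n)
  case 0
  with assms show ?thesis by (simp add: linear_mapsD(1)[OF shift_linear])
next
  case (Suc m)
  note ker = character_kernel_ideal[OF g]
  have "submodule_power R B (a_kernel B R g) (Suc m) \<subseteq> {x \<in> carrier B. shift x \<in> Jpow (Suc m)}"
  proof (induction m)
    case 0
    then show ?case using shift_kernel by (auto simp: character_kernel_iff)
  next
    case (Suc m)
    show ?case
    proof (rule submodule_power_Suc_Suc_least[OF ker
          submodule_vimage[OF module_axioms module_axioms shift_linear Jpow_submodule]])
      fix x u
      assume x: "x \<in> submodule_power R B (a_kernel B R g) (Suc m)" and u: "u \<in> a_kernel B R g"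
      have xu: "x \<in> carrier B" "u \<in> carrier B"
        using submodule_power_closed[OF ker x] u by (auto simp: character_kernel_iff)
      have "shift x \<in> Jpow (Suc m)" using Suc x by blast
      then have "shift x \<otimes>\<^bsub>B\<^esub> shift u \<in> Jpow (Suc (Suc m))"
        by (rule submodule_power_mult_ideal[OF augmentation_ideal_ideal _ shift_kernel[OF u]])
      with xu show "x \<otimes>\<^bsub>B\<^esub> u \<in> {x \<in> carrier B. shift x \<in> Jpow (Suc (Suc m))}"
        by (simp add: shift_mult)
    qed
  qed
  with assms Suc show ?thesis by blast
qed

text \<open>Convolution with \<open>g\<close> is composition with the translation, which carries \<open>(ker g)\<^sup>n\<close> into
  \<open>J\<^sup>n\<close>. A functional with this property is a generalized eigenvector for the eigenvalue \<open>g\<close>.\<close>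

lemma convolution_vanishes_on_kernel_power:
  assumes f: "f \<in> linear_maps R B S" "\<And>x. x \<in> Jpow n \<Longrightarrow> f x = \<zero>"
    and x: "x \<in> submodule_power R B (a_kernel B R g) n"
  shows "convolution R B \<Delta> f g x = \<zero>"
  using convolution_eq_shift[OF f(1)] f(2)[OF shift_kernel_power[OF x]]
    submodule_power_closed[OF character_kernel_ideal[OF g] x] by simp

end

section \<open>Independence of the invertible characters\<close>

lemma convolution_cancel_unit:
  assumes f: "f \<in> linear_maps R B S" and g: "g \<in> Units (character_monoid R B \<Delta> \<epsilon>)"
    and zero: "\<And>x. x \<in> carrier B \<Longrightarrow> convolution R B \<Delta> f g x = \<zero>" and x: "x \<in> carrier B"
  shows "f x = \<zero>"
proof -
  from g obtain g' where g': "g' \<in> algebra_homs R B S" "g \<in> algebra_homs R B S"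
    "convolution R B \<Delta> g g' = restrict \<epsilon> (carrier B)"
    by (auto simp: Units_def character_monoid_def)
  note lin = algebra_homsD(1)[OF g'(1)] algebra_homsD(1)[OF g'(2)]
  have "f x = convolution R B \<Delta> f (restrict \<epsilon> (carrier B)) x"
    using convolution_unit(2)[OF f restrict_linear[OF counit_linear] _ x] by simp
  also have "\<dots> = convolution R B \<Delta> (convolution R B \<Delta> f g) g' x"
    using convolution_assoc[OF f lin(2,1)] g'(3) by simp
  also have "\<dots> = \<zero>"
    by (rule convolution_zero_left[OF convolution_linear[OF f lin(2)] lin(1) zero x])
  finally show ?thesis .
qed

text \<open>The products \<open>s\<^sub>i \<circledast> g\<^sub>i\<close> in a relation are generalized eigenfunctionals for the distinct
  characters \<open>g\<^sub>i\<close>, hence each of them vanishes, and the invertible \<open>g\<^sub>i\<close> can be cancelled.\<close>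

lemma invertible_characters_independent:
  assumes dom: "domain R"
  shows "left_lin_indep_set dual filt_union (Units (character_monoid R B \<Delta> \<epsilon>))"
  unfolding left_lin_indep_set_def left_lin_indep_family_def
proof (intro allI impI ballI)
  fix n :: nat and g s i
  assume g: "g \<in> {..<n} \<rightarrow> Units (character_monoid R B \<Delta> \<epsilon>)" and inj: "inj_on g {..<n}"
    and s: "s \<in> {..<n} \<rightarrow> filt_union"
    and sum: "(\<Oplus>\<^bsub>dual\<^esub>i\<in>{..<n}. s i \<otimes>\<^bsub>dual\<^esub> g i) = \<zero>\<^bsub>dual\<^esub>" and i: "i < n"
  have gU: "g j \<in> Units (character_monoid R B \<Delta> \<epsilon>)" if "j \<in> {..<n}" for j using g that by blast
  have gc: "g j \<in> algebra_homs R B S" "g j \<in> extensional (carrier B)" if "j \<in> {..<n}" for j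
    using gU[OF that] by (auto simp: Units_def character_monoid_def)
  have gd: "g j \<in> carrier dual" if "j \<in> {..<n}" for j
    using gc[OF that] algebra_homsD(1) by (simp add: dual_simps(1))
  have sd: "s j \<in> carrier dual" if "j \<in> {..<n}" for j
    using s that D.submoduleE(1)[OF filt_union_submodule] by blast
  then have sl: "s j \<in> linear_maps R B S" if "j \<in> {..<n}" for j
    using that by (simp add: dual_simps(1))
  have "\<forall>j\<in>{..<n}. \<exists>k. \<forall>x\<in>Jpow k. s j x = \<zero>"
    using s by (fastforce simp: filt_union_iff filt_iff)
  then obtain N where N: "\<And>j x. \<lbrakk>j \<in> {..<n}; x \<in> Jpow (N j)\<rbrakk> \<Longrightarrow> s j x = \<zero>"
    by (metis (no_types, lifting))
  have "convolution R B \<Delta> (s i) (g i) x = \<zero>" if "x \<in> carrier B" for x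
  proof (rule generalized_eigenfunctionals_independent[where I = "{..<n}" and \<chi> = g and N = N
        and h = "\<lambda>j. convolution R B \<Delta> (s j) (g j)", OF dom])
    show "\<exists>x\<in>carrier B. g j x \<noteq> g k x" if "j \<in> {..<n}" "k \<in> {..<n}" "j \<noteq> k" for j k
    proof (rule ccontr)
      assume "\<not> ?thesis"
      then have "g j = g k"
        using extensionalityI[OF gc(2)[OF that(1)] gc(2)[OF that(2)]] by blast
      then show False using inj that by (auto dest: inj_onD)
    qed
    show "convolution R B \<Delta> (s j) (g j) y = \<zero>"
      if "j \<in> {..<n}" "y \<in> submodule_power R B (a_kernel B R (g j)) (N j)" for j y
      by (rule convolution_vanishes_on_kernel_power[OF gc(1)[OF that(1)] sl[OF that(1)] N[OF that(1)] that(2)])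
    show "(\<Oplus>j\<in>{..<n}. convolution R B \<Delta> (s j) (g j) y) = \<zero>" if "y \<in> carrier B" for y
    proof -
      have "(\<Oplus>j\<in>{..<n}. convolution R B \<Delta> (s j) (g j) y) =
          (\<Oplus>\<^bsub>dual\<^esub>j\<in>{..<n}. s j \<otimes>\<^bsub>dual\<^esub> g j) y"
        using dual_mult_closed sd gd that
        by (subst dual_finsum_apply) (auto simp: dual_simps(2))
      then show ?thesis using sum that by (simp add: dual_simps(4))
    qed
  qed (use gc convolution_linear sl algebra_homsD(1) i that in auto)
  then have "s i x = \<zero>" if "x \<in> carrier B" for x
    using convolution_cancel_unit[OF sl gU] i that by simp
  then show "s i = \<zero>\<^bsub>dual\<^esub>"
    using sd i by (intro dual_eqI D.zero_closed) (auto simp: dual_simps(4))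
qed

end

theorem theorem5p8:
  fixes R :: "('k, 'm) ring_scheme"
    and B :: "('k, 'b, 'p) module_scheme"
    and \<Delta> :: "'b \<Rightarrow> ('b \<times> 'b \<Rightarrow> 'k) set"
    and \<epsilon> :: "'b \<Rightarrow> 'k"
  assumes "bialgebra R B \<Delta> \<epsilon>"
  shows
    "(\<forall>N\<ge>-1. submodule (dual_filtration R B \<Delta> \<epsilon> N) R (dual_algebra R B \<Delta> \<epsilon>)) \<and>
     (\<forall>M N. -1 \<le> M \<longrightarrow> M \<le> N \<longrightarrow> dual_filtration R B \<Delta> \<epsilon> M \<subseteq> dual_filtration R B \<Delta> \<epsilon> N) \<and>
     dual_filtration R B \<Delta> \<epsilon> (-1) = {\<zero>\<^bsub>dual_algebra R B \<Delta> \<epsilon>\<^esub>} \<and>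
     (\<forall>p\<ge>-1. \<forall>q\<ge>-1.
        submodule_prod R (dual_algebra R B \<Delta> \<epsilon>)
          (dual_filtration R B \<Delta> \<epsilon> p) (dual_filtration R B \<Delta> \<epsilon> q)
        \<subseteq> dual_filtration R B \<Delta> \<epsilon> (p + q)) \<and>
     is_subalgebra R (dual_algebra R B \<Delta> \<epsilon>) (dual_filtration_union R B \<Delta> \<epsilon>) \<and>
     (domain R \<longrightarrow>
        left_lin_indep_set (dual_algebra R B \<Delta> \<epsilon>) (dual_filtration_union R B \<Delta> \<epsilon>)
          (Units (character_monoid R B \<Delta> \<epsilon>)))"
proof -
  interpret bialgebra R B \<Delta> \<epsilon> by fact
  show ?thesis
    using filt_submodule filt_mono filt_minus_one filt_prod_subset filt_union_subalgebra
      invertible_characters_independent by simp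
qed

end
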